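(* Let $r>0$ be any positive number and let $\Lambda(x)=x^r$ for $x\ge 0$. Let $0<\beta<1$, and let $$P_\beta(n,t)=\int_0^\infty \frac{e^{-\Lambda(u)}\Lambda(u)^n}{n!}\,h_\beta(t,u)\,du .$$ Then for every $z_0>0$, $$\lim_{\substack{t\to\infty\\ n t^{-r\beta}=z_0^r}} t^{r\beta}\,P_\beta(n,t)=\frac{z_0^{1-r}}{r}\,M_\beta(z_0),$$ where the limit is taken as $t\to\infty$ with the positive integer $n$ and $t>0$ related by $n t^{-r\beta}=z_0^r$. In particular, for $r=1$, i.e. for the standard fractional Poisson process, whose marginals $P_\beta(n,t)$ satisfy the fractional Kolmogorov-Feller equations $$\frac{d^\beta}{dt^\beta}P_\beta(n,t)=P_\beta(n-1,t)-P_\beta(n,t),\qquad n=0,1,2,\dots,$$ (with $P_\beta(-1,t)=0$, $P_\beta(0,0)=1$ and $P_\beta(n,0)=0$ for $n\ge1$), one has for every $z_0>0$ $$\lim_{\substack{t\to\infty\\ n t^{-\beta}=z_0}} t^{\beta}\,P_\beta(n,t)=M_\beta(z_0).$$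
   Context: For $0<\beta<1$ and $t,x>0$, $h_\beta$ is the density (in $x$) of the inverse $\beta$-stable subordinator: $$h_\beta(t,x)=\frac{t}{\beta x^{1+1/\beta}}\,g_\beta\left(\frac{t}{x^{1/\beta}}\right),\qquad g_\beta(u)=\frac1\pi\sum_{j=1}^\infty(-1)^{j+1}\frac{\Gamma(\beta j+1)}{\Gamma(j+1)}\frac{1}{u^{\beta j+1}}\sin(\beta\pi j)\quad(u>0).$$ The M-Wright function (Mainardi function) is $$M_\beta(z)=\frac1\pi\sum_{j=1}^\infty\frac{(-z)^{j-1}}{(j-1)!}\,\Gamma(\beta j)\,\sin(\pi\beta j).$$ The quantities $P_\beta(n,t)$, $n=0,1,2,\dots$, $t>0$, are the marginal probabilities of the fractional non-homogeneous Poisson process with cumulative intensity $\Lambda$; for $\Lambda(x)=x$ this is the standard fractional Poisson process (with rate $1$). The values at $t=0$ are given by the initial conditions $P_\beta(0,0)=1$ and $P_\beta(n,0)=0$ for $n\ge1$. The fractional derivative is the Caputo-Djrbashian derivative $$\frac{d^\beta}{dt^\beta}F(t)=\frac{1}{\Gamma(1-\beta)}\int_0^t\frac{1}{(t-s)^\beta}\,\frac{d}{ds}F(s)\,ds.$$ *)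

theory Defs
  imports "HOL-Analysis.Analysis"
begin

text \<open>Series over \<open>j \<ge> 1\<close> are written over \<open>Suc j\<close>.\<close>

definition stable_density :: "real \<Rightarrow> real \<Rightarrow> real" where
  "stable_density \<beta> u =
     1 / pi * (\<Sum>j. (-1) ^ (Suc j + 1) * (Gamma (\<beta> * real (Suc j) + 1) / Gamma (real (Suc j) + 1))
        * (1 / u powr (\<beta> * real (Suc j) + 1)) * sin (\<beta> * pi * real (Suc j)))"

definition inverse_stable_density :: "real \<Rightarrow> real \<Rightarrow> real \<Rightarrow> real" where
  "inverse_stable_density \<beta> t x =
     t / (\<beta> * x powr (1 + 1 / \<beta>)) * stable_density \<beta> (t / x powr (1 / \<beta>))"

definition M_Wright :: "real \<Rightarrow> real \<Rightarrow> real" where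
  "M_Wright \<beta> z =
     1 / pi * (\<Sum>j. (- z) ^ (Suc j - 1) / fact (Suc j - 1)
        * Gamma (\<beta> * real (Suc j)) * sin (pi * \<beta> * real (Suc j)))"

text \<open>The integral formula is meant for \<open>t > 0\<close>; the density has no value at \<open>t = 0\<close>, where the
  process starts in state 0. Negative \<open>t\<close> is irrelevant.\<close>

definition frac_poisson_prob :: "real \<Rightarrow> (real \<Rightarrow> real) \<Rightarrow> nat \<Rightarrow> real \<Rightarrow> real" where
  "frac_poisson_prob \<beta> \<Lambda> n t =
     (if t = 0 then (if n = 0 then 1 else 0)
      else (LINT u:{0<..}|lborel. exp (- \<Lambda> u) * \<Lambda> u ^ n / fact n * inverse_stable_density \<beta> t u))"

definition caputo_deriv :: "real \<Rightarrow> (real \<Rightarrow> real) \<Rightarrow> real \<Rightarrow> real" where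
  "caputo_deriv \<beta> F t =
     1 / Gamma (1 - \<beta>) * (LINT s:{0<..<t}|lborel. 1 / (t - s) powr \<beta> * deriv F s)"

text \<open>Conditions under which \<^const>\<open>caputo_deriv\<close> is not a default value: the derivative
  and the integral exist. Continuity on the closed interval ties the value at 0 to the values at
  positive times, so that an initial condition imposed at 0 has content.\<close>

definition caputo_differentiable :: "real \<Rightarrow> (real \<Rightarrow> real) \<Rightarrow> real \<Rightarrow> bool" where
  "caputo_differentiable \<beta> F t \<longleftrightarrow>
     continuous_on {0..t} F \<and> F differentiable_on {0<..<t} \<and>
     set_integrable lborel {0<..<t} (\<lambda>s. 1 / (t - s) powr \<beta> * deriv F s)"

text \<open>The pairs \<open>(n, t)\<close> on the curve \<open>n t\<^sup>-\<^sup>\<alpha> = c\<close> with \<open>n\<close> a positive integer, as \<open>t\<close> tends to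
  infinity.\<close>

definition scaling_filter :: "real \<Rightarrow> real \<Rightarrow> (nat \<times> real) filter" where
  "scaling_filter \<alpha> c =
     inf (filtercomap snd at_top)
         (principal {(n, t). n > 0 \<and> t > 0 \<and> real n * t powr (- \<alpha>) = c})"

lemma eventually_scaling_filter:
  "eventually Q (scaling_filter \<alpha> c) \<longleftrightarrow>
     (\<exists>T. \<forall>n t. t \<ge> T \<longrightarrow> n > 0 \<longrightarrow> t > 0 \<longrightarrow> real n * t powr (- \<alpha>) = c \<longrightarrow> Q (n, t))"
  by (auto simp: scaling_filter_def eventually_inf_principal
        eventually_filtercomap_at_top_linorder)

lemma scaling_filter_nontrivial:
  assumes "\<alpha> > 0" "c > 0"
  shows "scaling_filter \<alpha> c \<noteq> bot"
proof
  assume "scaling_filter \<alpha> c = bot"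
  then obtain T where
    T: "\<And>n t. t \<ge> T \<Longrightarrow> n > 0 \<Longrightarrow> t > 0 \<Longrightarrow> real n * t powr (- \<alpha>) \<noteq> c"
    unfolding trivial_limit_def eventually_scaling_filter by blast
  define S where "S = max T 1"
  obtain n where n: "real n > c * S powr \<alpha>"
    using reals_Archimedean2 by blast
  have S: "S > 0" by (simp add: S_def)
  have n0: "real n > 0"
    by (rule le_less_trans[OF _ n]) (use assms in simp)
  define t where "t = (real n / c) powr (1 / \<alpha>)"
  have ta: "t powr \<alpha> = real n / c"
    using assms n0 by (simp add: t_def powr_powr)
  have t0: "t > 0" using assms n0 by (simp add: t_def)
  have "S powr \<alpha> < t powr \<alpha>"
    using n assms by (simp add: ta field_simps)
  hence "S < t"
    using assms S t0 by (metis less_eq_real_def not_le powr_mono2)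
  hence "t \<ge> T" by (simp add: S_def)
  moreover have "real n * t powr (- \<alpha>) = c"
    using assms n0 by (simp add: powr_minus ta)
  ultimately show False using T[of t n] n0 t0 by simp
qed

end

theory Submission
  imports Defs
begin

text \<open>Comparing the two series term by term shows \<open>h\<^sub>\<beta>(t, u) = t\<^sup>-\<^sup>\<beta> M\<^sub>\<beta>(u t\<^sup>-\<^sup>\<beta>)\<close>
  (\<open>inverse_stable_density_eq\<close>), so that \<open>P\<^sub>\<beta>(n, t)\<close> is an average of the function
  \<open>M\<^sub>\<beta>\<close>.

  For the scaling limit, substitute \<open>u = t\<^sup>\<beta> z\<^sub>0 x\<^sup>1\<^sup>/\<^sup>r\<close>. On the curve \<open>n t\<^sup>-\<^sup>r\<^sup>\<beta> = z\<^sub>0\<^sup>r\<close> this turns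
  \<open>\<Lambda>(u)\<close> into \<open>n x\<close> and \<open>t\<^sup>r\<^sup>\<beta> P\<^sub>\<beta>(n, t)\<close> into the mean of a fixed function \<open>f\<close>, with
  \<open>f 1 = z\<^sub>0\<^sup>1\<^sup>-\<^sup>r M\<^sub>\<beta>(z\<^sub>0) / r\<close>, under the law of \<open>1/n\<close> times a Gamma variable of shape \<open>n + 1\<close>.
  These laws concentrate at 1 (\<open>gamma_kernel_concentration\<close>), provided that \<open>f\<close> is continuous at 1
  and of moderate growth.

  The difficulty is the growth of \<open>M\<^sub>\<beta>\<close>: an alternating power series with large coefficients says
  nothing about large arguments. Up to factorials its coefficients are values of the reciprocal
  Gamma function, so Hankel's formula (\<open>hankel_formula\<close>) turns the series into an integral of
  \<open>exp(\<sigma> - z \<sigma>\<^sup>\<beta>) \<sigma>\<^sup>\<beta>\<^sup>-\<^sup>1\<close> along a contour in the complex plane. As \<open>\<beta> < 1\<close>, the contour can be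
  chosen with \<open>exp \<sigma>\<close> decaying along it and \<open>Re \<sigma>\<^sup>\<beta>\<close> bounded below by a number that is as large as
  desired. So \<open>M\<^sub>\<beta>\<close> decays faster than every exponential (\<open>M_Wright_decay\<close>), and exchanging the
  two integrations evaluates its moments,
  \<open>\<integral> v\<^sup>k M\<^sub>\<beta>(v) dv = k! / \<Gamma>(\<beta> k + 1)\<close> (\<open>M_Wright_moment\<close>).

  For the equations with \<open>\<Lambda>(x) = x\<close>, expanding \<open>e\<^sup>-\<^sup>u\<close> and inserting the moments gives
  \<open>P\<^sub>\<beta>(n, t) = \<Sum>\<^sub>k (-1)\<^sup>n\<^sup>+\<^sup>k (k choose n) t\<^sup>\<beta>\<^sup>k / \<Gamma>(\<beta> k + 1)\<close>. The Caputo derivative acts on such a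
  series term by term and lowers the index \<open>k\<close> by one (\<open>caputo_deriv_power_series\<close>), after which
  Pascal's rule for the binomial coefficients is the Kolmogorov-Feller equation.\<close>

section \<open>Integration on the positive half-line\<close>

text \<open>With the half-line as a measure space of its own, hypotheses about positive arguments are
  hypotheses about all points of the space, and no indicator functions occur.\<close>
abbreviation halfline :: "real measure" where
  "halfline \<equiv> restrict_space lborel {0<..}"

lemma sigma_finite_halfline: "sigma_finite_measure halfline"
  by (intro sigma_finite_measure_restrict_space) (auto simp: sigma_finite_lborel)

lemma halfline_set_integral:
  fixes f :: "real \<Rightarrow> 'a::{banach, second_countable_topology}"
  shows "(LINT x:{0<..}|lborel. f x) = integral\<^sup>L halfline f"
  by (simp add: set_lebesgue_integral_def integral_restrict_space)

lemma halfline_set_integrable: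
  fixes f :: "real \<Rightarrow> 'a::{banach, second_countable_topology}"
  shows "set_integrable lborel {0<..} f \<longleftrightarrow> integrable halfline f"
  by (simp add: set_integrable_def integrable_restrict_space)

lemma measurable_halfline_continuous:
  fixes f :: "real \<Rightarrow> 'a::topological_space"
  assumes "continuous_on {0<..} f"
  shows "f \<in> borel_measurable halfline"
  using borel_measurable_continuous_on_restrict[OF assms]
  by (simp cong: measurable_cong_sets add: sets_restrict_space)

text \<open>Dominated convergence for series. Each series below has a sum of absolute values with an explicit
  integrable bound, mostly because it is an exponential series; to bound the integrals of the
  absolute values of the single terms would be harder.\<close>
lemma integrable_sums_dominated:
  fixes f :: "nat \<Rightarrow> 'a \<Rightarrow> 'b::{banach, second_countable_topology}"
  assumes "\<And>j. f j \<in> borel_measurable M" "F \<in> borel_measurable M" "integrable M g"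
    and "\<And>x. x \<in> space M \<Longrightarrow> (\<lambda>j. f j x) sums F x"
    and dom: "\<And>N x. x \<in> space M \<Longrightarrow> (\<Sum>j<N. norm (f j x)) \<le> g x"
  shows "\<And>j. integrable M (f j)" "integrable M F"
    "(\<lambda>j. integral\<^sup>L M (f j)) sums integral\<^sup>L M F"
proof -
  show int: "integrable M (f j)" for j
  proof (rule Bochner_Integration.integrable_bound[OF assms(3,1)], rule AE_I2)
    fix x assume x: "x \<in> space M"
    have "norm (f j x) \<le> (\<Sum>j<Suc j. norm (f j x))"
      by (rule member_le_sum) auto
    also have "\<dots> \<le> g x" by (rule dom[OF x])
    finally show "norm (f j x) \<le> norm (g x)" by simp
  qed
  have *: "norm (\<Sum>j<N. f j x) \<le> g x" if "x \<in> space M" for N x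
    using dom[OF that, of N] norm_sum[of "\<lambda>j. f j x" "{..<N}"] by simp
  show "integrable M F"
    by (rule integrable_dominated_convergence[where w = g and s = "\<lambda>N x. \<Sum>j<N. f j x"])
       (use assms * in \<open>auto simp: sums_def\<close>)
  have "(\<lambda>N. integral\<^sup>L M (\<lambda>x. \<Sum>j<N. f j x)) \<longlonglongrightarrow> integral\<^sup>L M F"
    by (rule integral_dominated_convergence[where w = g])
       (use assms * in \<open>auto simp: sums_def\<close>)
  then show "(\<lambda>j. integral\<^sup>L M (f j)) sums integral\<^sup>L M F"
    using int by (simp add: sums_def)
qed

lemma has_bochner_integral_halfline_nonneg:
  fixes f :: "real \<Rightarrow> real"
  assumes "(f has_integral I) {0<..}" "\<And>x. x > 0 \<Longrightarrow> f x \<ge> 0" "f \<in> borel_measurable halfline"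
  shows "integrable halfline f" "integral\<^sup>L halfline f = I"
proof -
  have "f absolutely_integrable_on {0<..}"
    using assms by (intro nonnegative_absolutely_integrable_1) (auto simp: has_integral_integrable)
  moreover have "set_borel_measurable lborel {0<..} f"
    using assms(3) by (simp add: set_borel_measurable_def borel_measurable_restrict_space_iff)
  ultimately have *: "set_integrable lborel {0<..} f"
    unfolding set_integrable_def set_borel_measurable_def by (simp add: integrable_completion)
  then show "integrable halfline f" by (simp add: halfline_set_integrable)
  from set_borel_integral_eq_integral(2)[OF *] assms(1)
  show "integral\<^sup>L halfline f = I" by (simp add: halfline_set_integral integral_unique)
qed

lemma integral_halfline_power_substitution:
  fixes f :: "real \<Rightarrow> real"
  assumes "A > 0" "q > 0" and f: "continuous_on {0<..} f"
    and int: "integrable halfline (\<lambda>x. A * q * x powr (q - 1) * f (A * x powr q))"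
  shows "integrable halfline f"
    and "integral\<^sup>L halfline f = integral\<^sup>L halfline (\<lambda>x. A * q * x powr (q - 1) * f (A * x powr q))"
proof -
  let ?g = "\<lambda>x. A * x powr q" and ?g' = "\<lambda>x. A * q * x powr (q - 1)"
  have img: "?g ` {0<..} = {0<..}"
  proof (intro equalityI subsetI)
    fix y :: real assume "y \<in> {0<..}"
    then have "y = ?g ((y / A) powr (1 / q))" "(y / A) powr (1 / q) \<in> {0<..}"
      using assms by (auto simp: powr_powr)
    then show "y \<in> ?g ` {0<..}" by blast
  qed (use assms in auto)
  have der: "(?g has_field_derivative ?g' x) (at x within {0<..})" if "x \<in> {0<..}" for x
    using that by (auto intro!: derivative_eq_intros)
  have inj: "inj_on ?g {0<..}"
  proof (rule inj_onI)
    fix x y :: real assume xy: "x \<in> {0<..}" "y \<in> {0<..}" "?g x = ?g y"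
    then have "(x powr q) powr (1 / q) = (y powr q) powr (1 / q)" using assms by simp
    then show "x = y" using xy assms by (simp add: powr_powr)
  qed
  have si: "set_integrable lborel {0<..} (\<lambda>x. ?g' x * f (?g x))"
    using int by (simp add: halfline_set_integrable mult.assoc)
  have abs: "(\<lambda>x. \<bar>?g' x\<bar> * f (?g x)) absolutely_integrable_on {0<..}"
    using si assms
    by (subst set_integrable_cong[OF refl refl, of _ _ "\<lambda>x. ?g' x * f (?g x)"])
       (auto simp: set_integrable_def integrable_completion)
  have "f absolutely_integrable_on ?g ` {0<..} \<and>
      integral (?g ` {0<..}) f = integral {0<..} (\<lambda>x. \<bar>?g' x\<bar> * f (?g x))"
    by (subst has_absolute_integral_change_of_variables_1'[symmetric, OF _ der inj]) (use abs in auto)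
  then have 1: "f absolutely_integrable_on {0<..}"
    and 2: "integral {0<..} f = integral {0<..} (\<lambda>x. \<bar>?g' x\<bar> * f (?g x))"
    by (auto simp only: img)
  have "set_borel_measurable lborel {0<..} f"
    using measurable_halfline_continuous[OF f]
    by (simp add: set_borel_measurable_def borel_measurable_restrict_space_iff)
  with 1 have fi: "set_integrable lborel {0<..} f"
    unfolding set_integrable_def set_borel_measurable_def by (simp add: integrable_completion)
  then show "integrable halfline f" by (simp add: halfline_set_integrable)
  have "integral\<^sup>L halfline f = integral {0<..} f"
    using set_borel_integral_eq_integral(2)[OF fi] by (simp add: halfline_set_integral)
  also have "\<dots> = integral {0<..} (\<lambda>x. ?g' x * f (?g x))"
    unfolding 2 using assms by (intro Henstock_Kurzweil_Integration.integral_cong) auto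
  also have "\<dots> = integral\<^sup>L halfline (\<lambda>x. ?g' x * f (?g x))"
    using set_borel_integral_eq_integral(2)[OF si] by (simp add: halfline_set_integral)
  finally show "integral\<^sup>L halfline f = integral\<^sup>L halfline (\<lambda>x. ?g' x * f (?g x))" .
qed

lemma Gamma_integral_scaled:
  fixes a b :: real
  assumes "a > 0" "b > 0"
  shows "integrable halfline (\<lambda>s. exp (- b * s) * s powr (a - 1))"
    and "integral\<^sup>L halfline (\<lambda>s. exp (- b * s) * s powr (a - 1)) = Gamma a * b powr (- a)"
proof -
  have hi: "((\<lambda>t. exp (- t) * t powr (a - 1)) has_integral Gamma a) {0<..}"
  proof (rule has_integral_eq)
    show "((\<lambda>t. Re (of_real t powr (of_real a - 1) / of_real (exp t))) has_integral Gamma a) {0<..}"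
      using has_integral_linear[OF Gamma_integral_complex'[of "of_real a"] bounded_linear_Re] assms
      by (simp add: o_def Gamma_complex_of_real)
    fix t :: real assume "t \<in> {0<..}"
    then have "complex_of_real t powr (of_real a - 1) = of_real (t powr (a - 1))"
      using powr_of_real[of t "a - 1"] by simp
    then show "Re (of_real t powr (of_real a - 1) / of_real (exp t)) = exp (- t) * t powr (a - 1)"
      by (simp add: exp_minus field_simps flip: of_real_divide)
  qed
  have co: "continuous_on {0<..} (\<lambda>t::real. exp (- t) * t powr (a - 1))"
    by (intro continuous_intros) auto
  note G = has_bochner_integral_halfline_nonneg[OF hi _ measurable_halfline_continuous[OF co], simplified]
  define f where "f = (\<lambda>t::real. b powr (1 - a) * (exp (- b * t) * t powr (a - 1)))"
  have cf: "continuous_on {0<..} f"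
    unfolding f_def by (intro continuous_intros) auto
  have eq: "1 / b * 1 * x powr (1 - 1) * f (1 / b * x powr 1) = b powr (-a) * b powr (1 - a) * (exp (- x) * x powr (a - 1))"
    if "x > 0" for x
    using that assms by (simp add: f_def powr_mult powr_divide powr_minus powr_diff field_simps)
  have i1: "integrable halfline (\<lambda>x. 1 / b * 1 * x powr (1 - 1) * f (1 / b * x powr 1))"
    using G(1) by (subst Bochner_Integration.integrable_cong[OF refl eq]) auto
  note S = integral_halfline_power_substitution[OF _ _ cf i1]
  have S1: "integrable halfline f" using S(1) assms by simp
  have S2: "integral\<^sup>L halfline f = b powr (-a) * b powr (1 - a) * Gamma a"
  proof -
    have "integral\<^sup>L halfline f = (LINT x|halfline. b powr (-a) * b powr (1 - a) * (exp (- x) * x powr (a - 1)))"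
      using S(2) assms Bochner_Integration.integral_cong[OF refl eq, of halfline "\<lambda>x. x"] by simp
    then show ?thesis by (simp add: G(2))
  qed
  show "integrable halfline (\<lambda>s. exp (- b * s) * s powr (a - 1))"
    using integrable_mult_right[OF S1, of "b powr (a - 1)"] assms
    by (simp add: f_def mult.assoc[symmetric] powr_add[symmetric])
  have "b powr (a - 1) * integral\<^sup>L halfline f = integral\<^sup>L halfline (\<lambda>s. exp (- b * s) * s powr (a - 1))"
    using assms unfolding integral_mult_right_zero[symmetric]
    by (simp add: f_def mult.assoc[symmetric] powr_add[symmetric])
  moreover have "b powr (a - 1) * (b powr (- a) * b powr (1 - a) * Gamma a) = Gamma a * b powr (- a)"
    using assms by (simp add: mult.assoc[symmetric] powr_add[symmetric])
  ultimately show "integral\<^sup>L halfline (\<lambda>s. exp (- b * s) * s powr (a - 1)) = Gamma a * b powr (- a)"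
    using S2 by simp
qed

lemma integrable_exp_decay:
  fixes f :: "real \<Rightarrow> 'a::{banach, second_countable_topology}"
  assumes "f \<in> borel_measurable halfline" "\<delta> > 0" "\<And>s. s > 0 \<Longrightarrow> norm (f s) \<le> C * exp (- \<delta> * s)"
  shows "integrable halfline f"
proof (rule Bochner_Integration.integrable_bound[OF _ assms(1)])
  have "integrable halfline (\<lambda>s. exp (- \<delta> * s) * s powr (1 - 1))"
    using Gamma_integral_scaled(1)[of 1 \<delta>] assms(2) by simp
  also have "?this \<longleftrightarrow> integrable halfline (\<lambda>s. exp (- \<delta> * s))"
    by (rule Bochner_Integration.integrable_cong) auto
  finally show "integrable halfline (\<lambda>s. C * exp (- \<delta> * s))" by simp
  show "AE x in halfline. norm (f x) \<le> norm (C * exp (- \<delta> * x))"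
    using assms(3) by (intro AE_I2) (force intro: order_trans[OF _ abs_ge_self])
qed

text \<open>Only the limits of the primitive at the two ends are used, which admits an integrand that is
  singular at 0.\<close>
lemma integral_halfline_FTC:
  fixes F f :: "real \<Rightarrow> complex"
  assumes "\<And>s. s > 0 \<Longrightarrow> (F has_vector_derivative f s) (at s)"
    and "continuous_on {0<..} f" "integrable halfline f"
    and "(F \<longlongrightarrow> A) (at_right 0)" "(F \<longlongrightarrow> B) at_top"
  shows "integral\<^sup>L halfline f = B - A"
proof -
  have "(LBINT s=0..\<infinity>. f s) = B - A"
  proof (rule interval_integral_FTC_integrable[where F = F])
    show "isCont f s" if "0 < ereal s" for s
      using assms(2) that by (simp add: continuous_on_eq_continuous_at open_greaterThan)
    show "set_integrable lborel (einterval 0 \<infinity>) f"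
      using assms(3) by (simp add: halfline_set_integrable zero_ereal_def)
    show "((F \<circ> real_of_ereal) \<longlongrightarrow> A) (at_right 0)"
      using assms(4) unfolding zero_ereal_def by (simp add: ereal_tendsto_simps1)
    show "((F \<circ> real_of_ereal) \<longlongrightarrow> B) (at_left \<infinity>)"
      using assms(5) by (simp add: ereal_tendsto_simps1)
  qed (use assms(1) in auto)
  then show ?thesis
    by (simp add: interval_lebesgue_integral_def zero_ereal_def halfline_set_integral)
qed

text \<open>From \<open>y \<le> e\<^sup>y\<close>, applied to a multiple of \<open>\<rho> + s\<close> and raised to the power \<open>e\<close>.\<close>
lemma shifted_powr_le_exp:
  fixes e \<epsilon> \<rho> :: real
  assumes "e \<ge> 0" "\<epsilon> > 0" "\<rho> \<ge> 0"
  obtains C where "C \<ge> 0" "\<And>s. s \<ge> 0 \<Longrightarrow> (\<rho> + s) powr e \<le> C * exp (\<epsilon> * s)"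
proof (cases "e = 0")
  case True
  have "(\<rho> + s) powr e \<le> 1 * exp (\<epsilon> * s)" if "s \<ge> 0" for s
  proof -
    have "(\<rho> + s) powr e \<le> 1" using True by simp
    also have "1 \<le> exp (\<epsilon> * s)" using assms that by simp
    finally show ?thesis by simp
  qed
  then show ?thesis using that[of 1] by auto
next
  case False
  then have e: "e > 0" using assms by simp
  have "(\<rho> + s) powr e \<le> ((e / \<epsilon>) powr e * exp (\<epsilon> * \<rho>)) * exp (\<epsilon> * s)" if "s \<ge> 0" for s
  proof -
    have "\<epsilon> / e * (\<rho> + s) \<le> exp (\<epsilon> / e * (\<rho> + s))"
      using exp_ge_add_one_self[of "\<epsilon> / e * (\<rho> + s)"] by linarith
    then have "\<rho> + s \<le> e / \<epsilon> * exp (\<epsilon> / e * (\<rho> + s))"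
      using e assms by (simp add: field_simps)
    then have "(\<rho> + s) powr e \<le> (e / \<epsilon> * exp (\<epsilon> / e * (\<rho> + s))) powr e"
      using e assms that by (intro powr_mono2) auto
    also have "\<dots> = (e / \<epsilon>) powr e * exp (\<epsilon> * (\<rho> + s))"
      using e assms by (subst powr_mult) (auto simp: powr_def[of "exp _"])
    finally show ?thesis by (simp add: exp_add ring_distribs mult_ac)
  qed
  then show ?thesis using that[of "(e / \<epsilon>) powr e * exp (\<epsilon> * \<rho>)"] by auto
qed

text \<open>Beyond the point \<open>X\<close> where \<open>(k + 1) X\<^sup>\<beta>\<^sup>-\<^sup>1 = \<epsilon>\<close> the linear function dominates; up to \<open>X\<close> the
  power is bounded.\<close>
lemma sublinear_powr_bound:
  fixes \<beta> \<epsilon> k \<rho> :: real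
  assumes "0 < \<beta>" "\<beta> < 1" "\<epsilon> > 0" "k \<ge> 0" "\<rho> \<ge> 0"
  obtains A where "\<And>s. s \<ge> 0 \<Longrightarrow> k * (\<rho> + s) powr \<beta> \<le> A + \<epsilon> * s"
proof -
  define X where "X = (\<epsilon> / (k + 1)) powr (1 / (\<beta> - 1))"
  have X: "X > 0" "X powr (\<beta> - 1) = \<epsilon> / (k + 1)"
    using assms by (auto simp: X_def powr_powr)
  have "k * (\<rho> + s) powr \<beta> \<le> (k * X powr \<beta> + \<epsilon> * \<rho>) + \<epsilon> * s" if s: "s \<ge> 0" for s
  proof (cases "\<rho> + s \<ge> X")
    case True
    have "(\<rho> + s) powr (\<beta> - 1) \<le> \<epsilon> / (k + 1)"
      using True X assms powr_mono2'[of "\<beta> - 1" X "\<rho> + s"] by simp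
    then have "k * (\<rho> + s) powr (\<beta> - 1) \<le> k * (\<epsilon> / (k + 1))" using assms by (intro mult_left_mono)
    also have "\<dots> \<le> \<epsilon>" using assms by (simp add: field_simps)
    finally have "k * (\<rho> + s) powr (\<beta> - 1) * (\<rho> + s) \<le> \<epsilon> * (\<rho> + s)"
      using assms s by (intro mult_right_mono) auto
    also have "k * (\<rho> + s) powr (\<beta> - 1) * (\<rho> + s) = k * (\<rho> + s) powr \<beta>"
      using True X by (simp add: powr_diff)
    finally have "k * (\<rho> + s) powr \<beta> \<le> \<epsilon> * (\<rho> + s)" .
    moreover have "0 \<le> k * X powr \<beta>" using assms by simp
    ultimately show ?thesis by (simp add: ring_distribs)
  next
    case False
    then have "k * (\<rho> + s) powr \<beta> \<le> k * X powr \<beta>"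
      using assms s by (intro mult_left_mono powr_mono2) auto
    moreover have "0 \<le> \<epsilon> * \<rho> + \<epsilon> * s" using assms s by simp
    ultimately show ?thesis by linarith
  qed
  then show ?thesis by (rule that)
qed

lemma powr_of_nat_mult: "w powr (of_nat n * a) = (w powr a) ^ n" if "w \<noteq> 0" for w a :: complex
  using that by (simp add: powr_def exp_of_nat_mult[symmetric] mult_ac)

lemma integrable_pair_product:
  fixes f g :: "real \<Rightarrow> real"
  assumes "integrable halfline f" "integrable halfline g"
  shows "integrable (halfline \<Otimes>\<^sub>M halfline) (\<lambda>(x, y). f x * g y)"
proof -
  interpret H: sigma_finite_measure halfline by (rule sigma_finite_halfline)
  interpret P: pair_sigma_finite halfline halfline ..
  have [measurable]: "f \<in> borel_measurable halfline" "g \<in> borel_measurable halfline"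
    using assms by auto
  show ?thesis
    by (rule P.Fubini_integrable) (use assms in \<open>auto simp: abs_mult\<close>)
qed

section \<open>Gamma integrals with complex rate\<close>

text \<open>Write \<open>c = b (1 + w)\<close> with \<open>b\<close> real. Expanding \<open>exp(-(c - b) s)\<close> in powers of \<open>s\<close> and integrating
  term by term yields the binomial series of \<open>(1 + w)\<^sup>-\<^sup>a\<close>. The expansion is dominated, and the
  binomial series converges, if \<open>\<bar>c - b\<bar> < b\<close>; for every \<open>c\<close> in the right half-plane all large
  \<open>b\<close> satisfy this.\<close>
lemma Gamma_integral_complex_scaled:
  fixes a :: real and c :: complex
  assumes "a > 0" "Re c > 0"
  shows "integral\<^sup>L halfline (\<lambda>s. exp (- c * of_real s) * of_real (s powr (a - 1)))
           = of_real (Gamma a) * c powr (- of_real a)"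
proof -
  \<comment> \<open>The inequality \<open>\<bar>c - b\<bar> < b\<close> means \<open>2 b Re c > \<bar>c\<bar>\<^sup>2\<close>; this is twice the infimum of all such \<open>b\<close>.\<close>
  define b where "b = (norm c)\<^sup>2 / Re c"
  define w where "w = c / of_real b - 1"
  have "c \<noteq> 0" using assms(2) by (metis less_irrefl zero_complex.sel(1))
  then have b: "b > 0" unfolding b_def by (intro divide_pos_pos assms) simp
  have "(norm (c - of_real b))\<^sup>2 = (norm c)\<^sup>2 - 2 * b * Re c + b\<^sup>2"
    unfolding cmod_power2 by (simp add: power2_eq_square algebra_simps)
  also have "\<dots> < b\<^sup>2" using \<open>c \<noteq> 0\<close> assms by (simp add: b_def)
  finally have cb: "norm (c - of_real b) < b"
    using b by (simp add: power_less_imp_less_base)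
  have w: "norm w < 1"
  proof -
    have "w = (c - of_real b) / of_real b" using b by (simp add: w_def field_simps)
    then show ?thesis using cb b by (simp add: norm_divide)
  qed
  let ?f = "\<lambda>k s. (of_real b - c) ^ k / fact k * of_real (exp (- b * s) * s powr (a + k - 1))"
  let ?F = "\<lambda>s. exp (- c * of_real s) * of_real (s powr (a - 1))"
  let ?g = "\<lambda>s. exp (- (b - norm (c - of_real b)) * s) * s powr (a - 1)"
  have fe: "?f k s = of_real (exp (- b * s) * s powr (a - 1)) * (((of_real b - c) * of_real s) ^ k /\<^sub>R fact k)"
    if "s > 0" for k s
    using that by (simp add: powr_add powr_diff powr_realpow power_mult_distrib scaleR_conv_of_real divide_simps)
  have sums: "(\<lambda>k. ?f k s) sums ?F s" if "s > 0" for s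
  proof -
    have "(\<lambda>k. ?f k s) sums (of_real (exp (- b * s) * s powr (a - 1)) * exp ((of_real b - c) * of_real s))"
      unfolding fe[OF that] by (intro sums_mult exp_converges)
    also have "of_real (exp (- b * s) * s powr (a - 1)) * exp ((of_real b - c) * of_real s) = ?F s"
      by (simp add: exp_of_real[symmetric] exp_add[symmetric] mult_ac ring_distribs del: exp_of_real)
    finally show ?thesis .
  qed
  have meas: "(\<lambda>s. ?f k s) \<in> borel_measurable halfline" "?F \<in> borel_measurable halfline" for k
    by (intro measurable_halfline_continuous continuous_intros; simp)+
  have dom: "(\<Sum>k<N. norm (?f k s)) \<le> ?g s" if "s > 0" for N s
  proof -
    have "(\<Sum>k<N. norm (?f k s)) = exp (- b * s) * s powr (a - 1) *
        (\<Sum>k<N. (norm (of_real b - c) * s) ^ k /\<^sub>R fact k)"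
      unfolding fe[OF that] sum_distrib_left using that
      by (intro sum.cong refl) (simp add: norm_mult norm_power norm_divide)
    also have "\<dots> \<le> exp (- b * s) * s powr (a - 1) * exp (norm (of_real b - c) * s)"
    proof (intro mult_left_mono)
      have "(\<Sum>k<N. (norm (of_real b - c) * s) ^ k /\<^sub>R fact k) \<le> (\<Sum>k. (norm (of_real b - c) * s) ^ k /\<^sub>R fact k)"
        using that by (intro sum_le_suminf summable_exp_generic) auto
      then show "(\<Sum>k<N. (norm (of_real b - c) * s) ^ k /\<^sub>R fact k) \<le> exp (norm (of_real b - c) * s)"
        by (simp add: exp_def)
    qed auto
    also have "\<dots> = ?g s"
      by (simp add: norm_minus_commute exp_add[symmetric] exp_diff algebra_simps divide_simps)
    finally show ?thesis .
  qed
  have gi: "integrable halfline ?g"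
    using Gamma_integral_scaled(1)[of a "b - norm (c - of_real b)"] assms cb by simp
  have S: "(\<lambda>k. integral\<^sup>L halfline (?f k)) sums integral\<^sup>L halfline ?F"
    by (rule integrable_sums_dominated(3)[OF meas gi]) (use sums dom in auto)
  have int: "integral\<^sup>L halfline (?f k) =
      of_real (Gamma a) * of_real b powr (- of_real a) * ((- of_real a gchoose k) * w ^ k)" for k
  proof -
    have "integral\<^sup>L halfline (?f k) = (of_real b - c) ^ k / fact k * of_real (Gamma (a + k) * b powr (- (a + k)))"
      using Gamma_integral_scaled(2)[of "a + k" b] assms b
      by (simp add: add_ac integral_complex_of_real del: of_real_mult)
    also have "Gamma (a + k) = pochhammer a k * Gamma a"
      using assms by (subst pochhammer_Gamma) (auto simp: Gamma_eq_zero_iff nonpos_Ints_def)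
    also have "b powr (- (a + k)) = b powr (-a) / b ^ k"
      using b by (simp add: powr_diff powr_realpow)
    finally have "integral\<^sup>L halfline (?f k) = (of_real b - c) ^ k / fact k *
        of_real (pochhammer a k * Gamma a * (b powr (- a) / b ^ k))" .
    moreover have "(of_real b - c) ^ k = (- w) ^ k * of_real b ^ k"
      using b by (simp add: w_def power_mult_distrib[symmetric] algebra_simps)
    ultimately have E: "integral\<^sup>L halfline (?f k) = (- w) ^ k * of_real b ^ k / fact k *
        of_real (pochhammer a k * Gamma a * (b powr (- a) / b ^ k))" by simp
    show ?thesis unfolding E using b
      by (simp add: gbinomial_pochhammer pochhammer_of_real powr_of_real[symmetric] power_minus[of w] field_simps)
  qed
  have "(\<lambda>k. of_real (Gamma a) * of_real b powr (- of_real a) * ((- of_real a gchoose k) * w ^ k)) sums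
      (of_real (Gamma a) * of_real b powr (- of_real a) * (1 + w) powr (- of_real a))"
    by (intro sums_mult gen_binomial_complex w)
  with S have "integral\<^sup>L halfline ?F = of_real (Gamma a) * (of_real b powr (- of_real a) * (1 + w) powr (- of_real a))"
    unfolding int using sums_unique2 by (auto simp: mult.assoc)
  also have "of_real b powr (- of_real a) * (1 + w) powr (- of_real a) = (of_real b * (1 + w)) powr (- of_real a)"
    using b by (subst powr_times_real_left) auto
  also have "of_real b * (1 + w) = c" using b by (simp add: w_def)
  finally show ?thesis .
qed

section \<open>Hankel's formula for the reciprocal Gamma function\<close>

text \<open>The upper half of a Hankel contour: it starts at \<open>\<rho>\<close> on the real axis and leaves at the angle \<open>\<theta>\<close>.
  The lower half is the mirror image, and the integrands are real on the real axis, so an integral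
  over the whole contour is \<open>2 \<i>\<close> times the imaginary part of the integral over this half. That is
  why only imaginary parts matter below.\<close>
definition ray :: "real \<Rightarrow> real \<Rightarrow> real \<Rightarrow> complex" where
  "ray \<theta> \<rho> s = of_real \<rho> + of_real s * cis \<theta>"

definition hankel_integral :: "real \<Rightarrow> real \<Rightarrow> real \<Rightarrow> complex" where
  "hankel_integral \<theta> \<rho> a =
     (LINT s|halfline. exp (ray \<theta> \<rho> s) * ray \<theta> \<rho> s powr of_real (a - 1) * cis \<theta>)"

text \<open>Euler's reflection formula, in a form that includes the integers, where \<open>\<Gamma>(1 - a)\<close> has poles.\<close>
lemma Gamma_sin_eq_rGamma:
  assumes "a > 0"
  shows "Gamma a * sin (pi * a) = pi * rGamma (1 - a)"
proof -
  have "rGamma (complex_of_real a) * rGamma (1 - of_real a) = sin (of_real pi * of_real a) / of_real pi"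
    by (rule rGamma_reflection_complex)
  then have "complex_of_real (rGamma a * rGamma (1 - a)) = complex_of_real (sin (pi * a) / pi)"
    by (simp add: rGamma_complex_of_real[symmetric] sin_of_real[symmetric])
  then have "rGamma a * rGamma (1 - a) = sin (pi * a) / pi"
    by (simp only: of_real_eq_iff)
  moreover have "Gamma a * rGamma a = 1"
    using assms Gamma_real_pos[of a] by (simp add: rGamma_inverse_Gamma del: Gamma_real_pos)
  ultimately show ?thesis
    by (metis (no_types) mult.assoc mult.commute mult.left_neutral nonzero_mult_div_cancel_left pi_neq_zero times_divide_eq_right)
qed

text \<open>Beyond \<open>\<pi>/2\<close> the exponential function decays along the ray; below \<open>\<pi>\<close> the ray keeps away from the
  cut of the power functions.\<close>
locale hankel_angle =
  fixes \<theta> :: real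
  assumes angle: "pi / 2 < \<theta>" "\<theta> < pi"
begin

abbreviation "\<gamma> \<equiv> - cos \<theta>"

lemma cos_neg: "cos \<theta> < 0"
proof -
  have "cos (pi - \<theta>) > 0" using angle by (intro cos_gt_zero) auto
  then show ?thesis by simp
qed

lemma sin_pos: "sin \<theta> > 0"
  using angle by (intro sin_gt_zero) auto

lemma Re_ray: "Re (ray \<theta> \<rho> s) = \<rho> + s * cos \<theta>" and Im_ray: "Im (ray \<theta> \<rho> s) = s * sin \<theta>"
  by (simp_all add: ray_def)

lemma ray_not_nonpos: "s \<ge> 0 \<Longrightarrow> \<rho> > 0 \<or> s > 0 \<Longrightarrow> ray \<theta> \<rho> s \<notin> \<real>\<^sub>\<le>\<^sub>0"
  using sin_pos by (auto simp: complex_nonpos_Reals_iff Re_ray Im_ray)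

lemma norm_ray_le: "\<rho> \<ge> 0 \<Longrightarrow> s \<ge> 0 \<Longrightarrow> norm (ray \<theta> \<rho> s) \<le> \<rho> + s"
  unfolding ray_def by (rule order_trans[OF norm_triangle_ineq]) (simp add: norm_mult)

text \<open>The number \<open>\<rho> sin \<theta>\<close> is the distance between the origin and the line that contains the ray.\<close>
lemma norm_ray_ge: assumes "\<rho> \<ge> 0" shows "norm (ray \<theta> \<rho> s) \<ge> \<rho> * sin \<theta>"
proof -
  have "\<rho> * sin \<theta> = - Im (cnj (cis \<theta>) * ray \<theta> \<rho> s)"
    by (simp add: ray_def algebra_simps)
  also have "\<dots> \<le> norm (cnj (cis \<theta>) * ray \<theta> \<rho> s)"
    using abs_Im_le_cmod[of "cnj (cis \<theta>) * ray \<theta> \<rho> s"] by linarith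
  finally show ?thesis by (simp add: norm_mult)
qed

lemma norm_exp_ray: "norm (exp (ray \<theta> \<rho> s)) = exp (\<rho> - \<gamma> * s)"
  by (simp add: Re_ray mult.commute)

lemma continuous_on_ray: "continuous_on A (ray \<theta> \<rho>)"
  unfolding ray_def by (intro continuous_intros)

lemma continuous_on_ray_powr:
  assumes "\<rho> \<ge> 0" shows "continuous_on {0<..} (\<lambda>s. ray \<theta> \<rho> s powr of_real e)"
  by (intro continuous_on_powr_complex continuous_on_ray continuous_intros)
     (use assms sin_pos in \<open>auto simp: Im_ray complex_eq_iff\<close>)

text \<open>For nonnegative exponents the bound is uniform over all starting points up to \<open>\<rho>\<close>, including the
  origin; this is what moving the starting point requires. A negative exponent is singular at the
  origin and admits a bound for one fixed starting point only.\<close>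
lemma ray_integrand_bound:
  assumes "\<rho> > 0 \<or> e \<ge> 0" "\<rho> \<ge> 0"
  shows "\<exists>C\<ge>0. \<forall>x\<in>{0..\<rho>}. \<forall>s>0. x = \<rho> \<or> e \<ge> 0 \<longrightarrow>
       norm (exp (ray \<theta> x s) * ray \<theta> x s powr of_real e) \<le> C * exp (- (\<gamma> / 2) * s)"
proof -
  have \<gamma>: "\<gamma> / 2 > 0" using cos_neg by simp
  obtain C where C: "C \<ge> 0" "\<And>s. s \<ge> 0 \<Longrightarrow> (\<rho> + s) powr max e 0 \<le> C * exp (\<gamma> / 2 * s)"
    using shifted_powr_le_exp[OF _ \<gamma> assms(2), of "max e 0"] by auto
  define K where "K = (if e \<ge> 0 then C else (\<rho> * sin \<theta>) powr e)"
  have K: "K \<ge> 0" using C by (simp add: K_def)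
  have bnd: "norm (exp (ray \<theta> x s) * ray \<theta> x s powr of_real e) \<le> (exp \<rho> * K) * exp (- (\<gamma> / 2) * s)"
    if "0 \<le> x" "x \<le> \<rho>" "s > 0" "x = \<rho> \<or> e \<ge> 0" for x s
  proof -
    have "norm (ray \<theta> x s) powr e \<le> K * exp (\<gamma> / 2 * s)"
    proof (cases "e \<ge> 0")
      case True
      then have "norm (ray \<theta> x s) powr e \<le> (\<rho> + s) powr e"
        using norm_ray_le[of x s] that by (intro powr_mono2) auto
      then show ?thesis using C(2)[of s] that True by (simp add: K_def max_def)
    next
      case False
      then have x: "x = \<rho>" "\<rho> > 0" using that assms by auto
      then have "norm (ray \<theta> x s) powr e \<le> (\<rho> * sin \<theta>) powr e"
        using norm_ray_ge[of x s] that assms False sin_pos by (intro powr_mono2') auto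
      also have "\<dots> \<le> (\<rho> * sin \<theta>) powr e * exp (\<gamma> / 2 * s)"
      proof -
        have "1 \<le> exp (\<gamma> / 2 * s)"
          using \<gamma> that by (simp only: one_le_exp_iff) (intro mult_nonneg_nonneg; simp)
        from mult_left_mono[OF this, of "(\<rho> * sin \<theta>) powr e"] show ?thesis by simp
      qed
      finally show ?thesis using False by (simp add: K_def)
    qed
    moreover have "exp (x - \<gamma> * s) \<le> exp \<rho> * exp (- \<gamma> * s)"
      using that by (simp add: exp_add[symmetric])
    ultimately have "norm (exp (ray \<theta> x s) * ray \<theta> x s powr of_real e)
        \<le> (exp \<rho> * exp (- \<gamma> * s)) * (K * exp (\<gamma> / 2 * s))"
      unfolding norm_mult norm_exp_ray by (intro mult_mono) (auto simp: norm_powr_real_powr')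
    also have "\<dots> = (exp \<rho> * K) * exp (- \<gamma> * s + \<gamma> / 2 * s)"
      by (simp only: exp_add mult_ac)
    also have "- \<gamma> * s + \<gamma> / 2 * s = - (\<gamma> / 2) * s" by (simp add: field_simps)
    finally show ?thesis .
  qed
  show ?thesis by (rule exI[of _ "exp \<rho> * K"]) (use K bnd in auto)
qed

lemma ray_integrable:
  assumes "\<rho> > 0 \<or> e \<ge> 0" "\<rho> \<ge> 0"
  shows "integrable halfline (\<lambda>s. exp (ray \<theta> \<rho> s) * ray \<theta> \<rho> s powr of_real e * cis \<theta>)"
proof -
  obtain C where "C \<ge> 0" and C: "\<And>x s. 0 \<le> x \<Longrightarrow> x \<le> \<rho> \<Longrightarrow> s > 0 \<Longrightarrow> x = \<rho> \<or> e \<ge> 0 \<Longrightarrow>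
       norm (exp (ray \<theta> x s) * ray \<theta> x s powr of_real e) \<le> C * exp (- (\<gamma> / 2) * s)"
    using ray_integrand_bound[OF assms] by (meson atLeastAtMost_iff)
  show ?thesis
    by (rule integrable_exp_decay[where \<delta> = "\<gamma> / 2" and C = C])
       (use C[of \<rho>] assms cos_neg in \<open>auto simp: norm_mult intro!: measurable_halfline_continuous
          continuous_intros continuous_on_ray continuous_on_ray_powr\<close>)
qed

text \<open>The same function \<open>e\<^sup>\<sigma> \<sigma>\<^sup>e\<close> is differentiated along the ray and in the direction of the
  starting point; the two derivatives differ by the factor \<open>cis \<theta>\<close> alone.\<close>
lemma ray_primitive_derivative:
  fixes e :: real
  assumes "s \<ge> 0" "x > 0 \<or> s > 0"
  defines "D \<equiv> exp (ray \<theta> x s) * ray \<theta> x s powr of_real e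
     + of_real e * (exp (ray \<theta> x s) * ray \<theta> x s powr of_real (e - 1))"
  shows "((\<lambda>s. exp (ray \<theta> x s) * ray \<theta> x s powr of_real e) has_vector_derivative D * cis \<theta>) (at s)"
    and "((\<lambda>x. exp (ray \<theta> x s) * ray \<theta> x s powr of_real e) has_vector_derivative D) (at x)"
proof -
  have n: "ray \<theta> x s \<notin> \<real>\<^sub>\<le>\<^sub>0" by (rule ray_not_nonpos) (use assms in auto)
  have f: "((\<lambda>w. exp w * w powr of_real e) has_field_derivative D) (at (ray \<theta> x s))"
    unfolding D_def using n by (auto intro!: derivative_eq_intros simp: algebra_simps)
  have 1: "((\<lambda>s. ray \<theta> x s) has_vector_derivative cis \<theta>) (at s)"
    unfolding ray_def by (auto intro!: derivative_eq_intros)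
  have 2: "((\<lambda>x. ray \<theta> x s) has_vector_derivative 1) (at x)"
    unfolding ray_def by (auto intro!: derivative_eq_intros)
  show "((\<lambda>s. exp (ray \<theta> x s) * ray \<theta> x s powr of_real e) has_vector_derivative D * cis \<theta>) (at s)"
    using field_vector_diff_chain_at[OF 1 f] by (simp add: o_def mult.commute)
  show "((\<lambda>x. exp (ray \<theta> x s) * ray \<theta> x s powr of_real e) has_vector_derivative D) (at x)"
    using field_vector_diff_chain_at[OF 2 f] by (simp add: o_def)
qed

text \<open>The boundary term sits at the starting point of the ray, and is therefore real.\<close>
lemma ray_FTC:
  assumes "x > 0 \<or> e \<ge> 1" "x \<ge> 0"
  shows "(LINT s|halfline. (exp (ray \<theta> x s) * ray \<theta> x s powr of_real e
     + of_real e * (exp (ray \<theta> x s) * ray \<theta> x s powr of_real (e - 1))) * cis \<theta>)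
     = of_real (- (exp x * x powr e))"
proof -
  let ?F = "\<lambda>s. exp (ray \<theta> x s) * ray \<theta> x s powr of_real e"
  have xe: "x > 0 \<or> e \<ge> 0" using assms by auto
  obtain C where "C \<ge> 0" and C: "\<And>y s. 0 \<le> y \<Longrightarrow> y \<le> x \<Longrightarrow> s > 0 \<Longrightarrow> y = x \<or> e \<ge> 0 \<Longrightarrow>
       norm (exp (ray \<theta> y s) * ray \<theta> y s powr of_real e) \<le> C * exp (- (\<gamma> / 2) * s)"
    using ray_integrand_bound[OF xe assms(2)] by (meson atLeastAtMost_iff)
  have int: "integrable halfline (\<lambda>s. (exp (ray \<theta> x s) * ray \<theta> x s powr of_real e
     + of_real e * (exp (ray \<theta> x s) * ray \<theta> x s powr of_real (e - 1))) * cis \<theta>)"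
    using ray_integrable[of x e] ray_integrable[of x "e - 1"] assms
    by (auto simp: ring_distribs mult.assoc)
  have zero: "(?F \<longlongrightarrow> 0) at_top"
  proof (rule Lim_null_comparison)
    show "\<forall>\<^sub>F s in at_top. norm (?F s) \<le> C * exp (- (\<gamma> / 2) * s)"
      using eventually_gt_at_top[of 0] by eventually_elim (use C[of x] assms in auto)
    have "filterlim (\<lambda>s. (\<gamma> / 2) * s) at_top at_top"
      using cos_neg by (intro filterlim_tendsto_pos_mult_at_top[OF tendsto_const] filterlim_ident) auto
    then have "((\<lambda>s. exp (- ((\<gamma> / 2) * s))) \<longlongrightarrow> 0) at_top"
      by (intro filterlim_compose[OF exp_at_bot]) (simp add: filterlim_uminus_at_bot)
    then show "((\<lambda>s. C * exp (- (\<gamma> / 2) * s)) \<longlongrightarrow> 0) at_top"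
      by (intro tendsto_mult_right_zero) simp
  qed
  have "continuous_on {0..} ?F"
    by (intro continuous_intros continuous_on_powr_complex continuous_on_ray)
       (use assms sin_pos in \<open>auto simp: Im_ray Re_ray complex_eq_iff\<close>)
  then have "continuous (at 0 within {0..}) ?F" by (auto simp: continuous_on_eq_continuous_within)
  then have "(?F \<longlongrightarrow> ?F 0) (at_right 0)"
    unfolding continuous_within by (rule tendsto_within_subset) auto
  moreover have "?F 0 = of_real (exp x * x powr e)"
    using assms by (simp add: ray_def powr_of_real flip: exp_of_real)
  ultimately have lim0: "(?F \<longlongrightarrow> of_real (exp x * x powr e)) (at_right 0)" by simp
  have "(LINT s|halfline. (exp (ray \<theta> x s) * ray \<theta> x s powr of_real e
     + of_real e * (exp (ray \<theta> x s) * ray \<theta> x s powr of_real (e - 1))) * cis \<theta>)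
     = 0 - of_real (exp x * x powr e)"
    by (rule integral_halfline_FTC[OF _ _ int lim0 zero])
       (use assms in \<open>auto simp del: of_real_diff intro!: ray_primitive_derivative continuous_on_mult
          continuous_on_add continuous_on_exp continuous_on_const continuous_on_ray continuous_on_ray_powr\<close>)
  then show ?thesis by simp
qed

text \<open>Integration by parts; the boundary term is real and drops out of the imaginary part.\<close>
lemma hankel_recurrence:
  assumes "\<rho> > 0"
  shows "Im (hankel_integral \<theta> \<rho> a) = (1 - a) * Im (hankel_integral \<theta> \<rho> (a - 1))"
proof -
  have "hankel_integral \<theta> \<rho> a + of_real (a - 1) * hankel_integral \<theta> \<rho> (a - 1)
      = of_real (- (exp \<rho> * \<rho> powr (a - 1)))"
  proof -
    have "hankel_integral \<theta> \<rho> a + of_real (a - 1) * hankel_integral \<theta> \<rho> (a - 1) =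
        (LINT s|halfline. exp (ray \<theta> \<rho> s) * ray \<theta> \<rho> s powr of_real (a - 1) * cis \<theta>
          + of_real (a - 1) * (exp (ray \<theta> \<rho> s) * ray \<theta> \<rho> s powr of_real (a - 1 - 1) * cis \<theta>))"
      unfolding hankel_integral_def integral_mult_right_zero[symmetric]
      by (intro Bochner_Integration.integral_add[symmetric] integrable_mult_right ray_integrable)
         (use assms in auto)
    also have "\<dots> = of_real (- (exp \<rho> * \<rho> powr (a - 1)))"
      using ray_FTC[of \<rho> "a - 1"] assms by (simp only: ring_distribs mult.assoc) simp
    finally show ?thesis .
  qed
  from arg_cong[OF this, of Im] show ?thesis by (simp add: algebra_simps)
qed

lemma borel_measurable_ray_powr:
  "(\<lambda>(x, s). ray \<theta> x s powr of_real e) \<in> borel_measurable (restrict_space lborel {0..\<rho>} \<Otimes>\<^sub>M halfline)"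
proof -
  let ?M = "restrict_space lborel {0..\<rho>} \<Otimes>\<^sub>M halfline"
  have [measurable]: "(\<lambda>w. indicator {w. Im w > 0} w *\<^sub>R (w powr of_real e)) \<in> borel_measurable borel"
    by (intro borel_measurable_continuous_on_indicator continuous_intros continuous_on_powr_complex)
       (auto intro!: borel_open open_halfspace_Im_gt)
  have [measurable]: "(\<lambda>p. fst p) \<in> ?M \<rightarrow>\<^sub>M borel" "(\<lambda>p. snd p) \<in> ?M \<rightarrow>\<^sub>M borel"
    by (auto intro!: measurable_compose[OF measurable_fst] measurable_compose[OF measurable_snd]
         measurable_restrict_space1)
  have "(\<lambda>p. ray \<theta> (fst p) (snd p)) \<in> borel_measurable ?M"
    unfolding ray_def by measurable
  from measurable_compose[OF this, of "\<lambda>w. indicator {w. Im w > 0} w *\<^sub>R (w powr of_real e)" borel]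
  have "(\<lambda>p. indicator {w. Im w > 0} (ray \<theta> (fst p) (snd p)) *\<^sub>R (ray \<theta> (fst p) (snd p) powr of_real e))
      \<in> borel_measurable ?M" by simp
  also have "?this \<longleftrightarrow> ?thesis"
    by (rule measurable_cong) (use sin_pos in \<open>auto simp: space_pair_measure indicator_def Im_ray\<close>)
  finally show ?thesis .
qed

text \<open>The contour may be moved to the origin: the difference of the two integrals is a double integral
  of the derivative of the integrand over the strip between the rays, and integrating along the
  rays first leaves boundary terms on the real axis, which are real. For \<open>a \<ge> 2\<close> the derivative is
  bounded near the origin, so that Fubini's theorem applies.\<close>
lemma hankel_shift:
  assumes "a \<ge> 2" "\<rho> > 0"
  shows "Im (hankel_integral \<theta> \<rho> a) = Im (hankel_integral \<theta> 0 a)"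
proof -
  define I where "I = restrict_space lborel {0..\<rho>}"
  interpret H: sigma_finite_measure halfline by (rule sigma_finite_halfline)
  interpret I: finite_measure I
    by (intro finite_measureI) (use assms in \<open>simp add: I_def emeasure_restrict_space\<close>)
  interpret P: pair_sigma_finite I halfline ..
  let ?e = "a - 1"
  define D where "D = (\<lambda>x s. (exp (ray \<theta> x s) * ray \<theta> x s powr of_real ?e
     + of_real ?e * (exp (ray \<theta> x s) * ray \<theta> x s powr of_real (?e - 1))) * cis \<theta>)"
  obtain C1 where C1: "C1 \<ge> 0" "\<And>x s. 0 \<le> x \<Longrightarrow> x \<le> \<rho> \<Longrightarrow> s > 0 \<Longrightarrow>
       norm (exp (ray \<theta> x s) * ray \<theta> x s powr of_real ?e) \<le> C1 * exp (- (\<gamma> / 2) * s)"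
    using ray_integrand_bound[of \<rho> ?e] assms by (auto simp del: of_real_diff)
  obtain C2 where C2: "C2 \<ge> 0" "\<And>x s. 0 \<le> x \<Longrightarrow> x \<le> \<rho> \<Longrightarrow> s > 0 \<Longrightarrow>
       norm (exp (ray \<theta> x s) * ray \<theta> x s powr of_real (?e - 1)) \<le> C2 * exp (- (\<gamma> / 2) * s)"
    using ray_integrand_bound[of \<rho> "?e - 1"] assms by (auto simp del: of_real_diff)
  define g where "g = (\<lambda>s. (C1 + ?e * C2) * exp (- (\<gamma> / 2) * s))"
  have Dg: "norm (D x s) \<le> g s" if "0 \<le> x" "x \<le> \<rho>" "s > 0" for x s
  proof -
    have "norm (D x s) \<le> C1 * exp (- (\<gamma> / 2) * s) + ?e * (C2 * exp (- (\<gamma> / 2) * s))"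
      unfolding D_def norm_mult[of _ "cis _"] norm_cis mult_1_right
      using C1(2)[OF that] C2(2)[OF that] assms
      by (intro order_trans[OF norm_triangle_ineq] add_mono)
         (auto simp: norm_mult[of "of_real _"] simp del: of_real_diff intro!: mult_left_mono)
    then show ?thesis by (simp add: g_def algebra_simps)
  qed
  have gm: "g \<in> borel_measurable halfline"
    unfolding g_def by (intro measurable_halfline_continuous continuous_intros)
  have gi: "integrable halfline g"
    by (rule integrable_exp_decay[OF gm, of "\<gamma> / 2" "\<bar>C1 + ?e * C2\<bar>"]) (use cos_neg in \<open>auto simp: g_def abs_mult\<close>)
  have [measurable]: "(\<lambda>p. fst p) \<in> (I \<Otimes>\<^sub>M halfline) \<rightarrow>\<^sub>M borel" "(\<lambda>p. snd p) \<in> (I \<Otimes>\<^sub>M halfline) \<rightarrow>\<^sub>M borel"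
    by (auto intro!: measurable_compose[OF measurable_fst] measurable_compose[OF measurable_snd]
         measurable_restrict_space1 simp: I_def)
  have [measurable]: "(\<lambda>p. ray \<theta> (fst p) (snd p) powr of_real e) \<in> borel_measurable (I \<Otimes>\<^sub>M halfline)" for e
    using borel_measurable_ray_powr[of e \<rho>] by (simp add: I_def case_prod_unfold)
  have Dm: "case_prod D \<in> borel_measurable (I \<Otimes>\<^sub>M halfline)"
    unfolding D_def case_prod_unfold by (subst (1 2) ray_def) measurable
  have "integrable (I \<Otimes>\<^sub>M halfline) (\<lambda>(x, s). g s)"
    by (rule P.Fubini_integrable)
       (use gi in \<open>auto intro!: measurable_compose[OF measurable_snd gm] simp: case_prod_unfold\<close>)
  then have "integrable (I \<Otimes>\<^sub>M halfline) (case_prod D)"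
    by (rule Bochner_Integration.integrable_bound[OF _ Dm])
       (auto intro!: AE_I2 Dg[THEN order_trans] simp: space_pair_measure I_def)
  from P.Fubini_integral[OF this]
  have fub: "(LINT s|halfline. LINT x|I. D x s) = (LINT x|I. LINT s|halfline. D x s)" .
  have "(LINT s|halfline. LINT x|I. D x s) =
      (LINT s|halfline. exp (ray \<theta> \<rho> s) * ray \<theta> \<rho> s powr of_real ?e * cis \<theta>
         - exp (ray \<theta> 0 s) * ray \<theta> 0 s powr of_real ?e * cis \<theta>)"
  proof (rule Bochner_Integration.integral_cong[OF refl])
    fix s assume "s \<in> space halfline"
    then have s: "s > 0" by simp
    let ?D = "\<lambda>x. exp (ray \<theta> x s) * ray \<theta> x s powr of_real ?e
     + of_real ?e * (exp (ray \<theta> x s) * ray \<theta> x s powr of_real (?e - 1))"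
    have c: "continuous_on {0..\<rho>} (\<lambda>x. ray \<theta> x s)"
      unfolding ray_def by (intro continuous_intros)
    have "(LINT x|I. D x s) = (LINT x|I. ?D x) * cis \<theta>"
      unfolding D_def by simp
    also have "(LINT x|I. ?D x) = (LBINT x. indicator {0..\<rho>} x *\<^sub>R ?D x)"
      unfolding I_def by (simp add: integral_restrict_space)
    also have "\<dots> = exp (ray \<theta> \<rho> s) * ray \<theta> \<rho> s powr of_real ?e - exp (ray \<theta> 0 s) * ray \<theta> 0 s powr of_real ?e"
    proof (rule integral_FTC_atLeastAtMost)
      show "continuous_on {0..\<rho>} ?D"
        by (intro continuous_intros continuous_on_powr_complex c) (use s sin_pos in \<open>auto simp: Im_ray complex_eq_iff\<close>)
      show "((\<lambda>x. exp (ray \<theta> x s) * ray \<theta> x s powr of_real ?e) has_vector_derivative ?D x) (at x within {0..\<rho>})" for x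
        using s by (intro has_vector_derivative_at_within[OF ray_primitive_derivative(2)]) auto
    qed (use assms in simp)
    finally show "(LINT x|I. D x s) = exp (ray \<theta> \<rho> s) * ray \<theta> \<rho> s powr of_real ?e * cis \<theta>
         - exp (ray \<theta> 0 s) * ray \<theta> 0 s powr of_real ?e * cis \<theta>"
      by (simp add: left_diff_distrib)
  qed
  also have "\<dots> = hankel_integral \<theta> \<rho> a - hankel_integral \<theta> 0 a"
    unfolding hankel_integral_def using assms
    by (intro Bochner_Integration.integral_diff ray_integrable) auto
  also have "(LINT s|halfline. LINT x|I. D x s) = (LINT x|I. of_real (- (exp x * x powr ?e)))"
    unfolding fub unfolding D_def
    by (intro Bochner_Integration.integral_cong refl ray_FTC) (use assms in \<open>auto simp: I_def\<close>)
  finally have "hankel_integral \<theta> \<rho> a - hankel_integral \<theta> 0 a = of_real (LINT x|I. - (exp x * x powr ?e))"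
    by (simp only: integral_complex_of_real)
  from arg_cong[OF this, of Im] show ?thesis by simp
qed

text \<open>From the origin the integral is a Gamma integral with the complex rate \<open>-cis \<theta> = cis (\<theta> - \<pi>)\<close>,
  whose real part is positive.\<close>
lemma hankel_origin:
  assumes "a > 0"
  shows "hankel_integral \<theta> 0 a = of_real (Gamma a) * cis (pi * a)"
proof -
  have "hankel_integral \<theta> 0 a =
      (LINT s|halfline. cis (\<theta> * a) * (exp (- (- cis \<theta>) * of_real s) * of_real (s powr (a - 1))))"
    unfolding hankel_integral_def
  proof (rule Bochner_Integration.integral_cong[OF refl])
    fix s assume "s \<in> space halfline"
    then have s: "s > 0" by simp
    have "ray \<theta> 0 s powr of_real (a - 1) = of_real (s powr (a - 1)) * cis \<theta> powr of_real (a - 1)"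
      using s powr_times_real_left[of "of_real s" "cis \<theta>" "of_real (a - 1)"] powr_of_real[of s "a - 1"]
      by (simp add: ray_def del: of_real_diff)
    also have "cis \<theta> powr of_real (a - 1) = cis (\<theta> * (a - 1))"
      using angle by (simp add: powr_def Ln_cis cis_conv_exp mult_ac)
    finally show "exp (ray \<theta> 0 s) * ray \<theta> 0 s powr of_real (a - 1) * cis \<theta> =
        cis (\<theta> * a) * (exp (- (- cis \<theta>) * of_real s) * of_real (s powr (a - 1)))"
      by (simp add: ray_def cis_mult mult_ac algebra_simps)
  qed
  also have "\<dots> = cis (\<theta> * a) * (of_real (Gamma a) * (- cis \<theta>) powr (- of_real a))"
    using assms cos_neg by (subst integral_mult_right_zero, subst Gamma_integral_complex_scaled) auto
  also have "- cis \<theta> = cis (\<theta> - pi)"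
    by (simp add: complex_eq_iff cos_diff sin_diff)
  also have "cis (\<theta> - pi) powr (- of_real a) = cis (- a * (\<theta> - pi))"
    using angle by (simp add: powr_def Ln_cis cis_conv_exp mult_ac)
  finally show ?thesis by (simp add: cis_mult algebra_simps)
qed

text \<open>Moving the contour to the origin settles \<open>a \<ge> 2\<close>, and the recurrence descends from there to all
  \<open>a\<close> that are not integers. At \<open>a = 1\<close> the recurrence degenerates to \<open>0 = 0\<close>, which loses the
  values at the integers below; these follow by continuity in \<open>a\<close>.\<close>
theorem hankel_formula:
  assumes "\<rho> > 0"
  shows "Im (hankel_integral \<theta> \<rho> a) = pi * rGamma (1 - a)"
proof -
  have base: "Im (hankel_integral \<theta> \<rho> a) = pi * rGamma (1 - a)" if "a \<ge> 2" for a
    using that assms by (simp add: hankel_shift hankel_origin Gamma_sin_eq_rGamma)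
  have nonint: "Im (hankel_integral \<theta> \<rho> a) = pi * rGamma (1 - a)" if "a \<notin> \<int>" for a
  proof -
    obtain m :: nat where "a + m \<ge> 2" using real_arch_simple[of "2 - a"] by (auto simp: algebra_simps)
    then show ?thesis using that
    proof (induction m arbitrary: a)
      case 0
      then show ?case using base by simp
    next
      case (Suc m)
      have "Im (hankel_integral \<theta> \<rho> (a + 1)) = pi * rGamma (1 - (a + 1))"
        by (rule Suc.IH) (use Suc.prems in auto)
      moreover have "Im (hankel_integral \<theta> \<rho> (a + 1)) = - a * Im (hankel_integral \<theta> \<rho> a)"
        using hankel_recurrence[OF assms, of "a + 1"] by simp
      moreover have "- a * rGamma (1 - a) = rGamma (- a)" using rGamma_plus1[of "- a"] by (simp add: add.commute)
      ultimately have "- a * Im (hankel_integral \<theta> \<rho> a) = - a * (pi * rGamma (1 - a))"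
        by (simp add: mult.left_commute)
      moreover have "- a \<noteq> 0" using Suc.prems by auto
      ultimately show ?case by (metis mult_left_cancel)
    qed
  qed
  \<comment> \<open>A sequence with limit \<open>a\<close> inside \<open>(a, a + 1)\<close>; it avoids the integers if \<open>a\<close> is one.\<close>
  define b where "b = (\<lambda>n::nat. a + 1 / real (n + 2))"
  have b: "b \<longlonglongrightarrow> a"
    proof -
    have "(\<lambda>n. a + inverse (real (Suc (n + 1)))) \<longlonglongrightarrow> a + 0"
      by (intro tendsto_intros LIMSEQ_ignore_initial_segment[OF LIMSEQ_inverse_real_of_nat])
    then show ?thesis by (simp add: b_def inverse_eq_divide add_ac)
  qed
  show ?thesis
  proof (cases "a \<in> \<int>")
    case False then show ?thesis by (rule nonint)
  next
    case True
    have bn: "b n \<notin> \<int>" for n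
    proof
      assume "b n \<in> \<int>"
      with True have "b n - a \<in> \<int>" by (intro Ints_diff)
      then have "1 / real (n + 2) \<in> \<int>" by (simp add: b_def)
      then obtain k :: int where "1 / real (n + 2) = of_int k" by (auto elim: Ints_cases)
      moreover have "0 < 1 / real (n + 2)" "1 / real (n + 2) < 1" by auto
      ultimately have "0 < k" "k < 1" by linarith+
      then show False by simp
    qed
    have "(\<lambda>n. hankel_integral \<theta> \<rho> (b n)) \<longlonglongrightarrow> hankel_integral \<theta> \<rho> a"
      unfolding hankel_integral_def
    proof (rule integral_dominated_convergence)
      let ?w = "\<lambda>s. norm (exp (ray \<theta> \<rho> s) * ray \<theta> \<rho> s powr of_real (a - 1) * cis \<theta>)
        + norm (exp (ray \<theta> \<rho> s) * ray \<theta> \<rho> s powr of_real a * cis \<theta>)"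
      show "integrable halfline ?w"
        using assms by (intro Bochner_Integration.integrable_add integrable_norm ray_integrable) auto
      show "AE s in halfline. norm (exp (ray \<theta> \<rho> s) * ray \<theta> \<rho> s powr of_real (b n - 1) * cis \<theta>) \<le> ?w s" for n
      proof (rule AE_I2)
        fix s assume "s \<in> space halfline"
        have ab: "a - 1 \<le> b n - 1" "b n - 1 \<le> a" by (auto simp: b_def)
        let ?r = "norm (ray \<theta> \<rho> s)"
        have "?r powr (b n - 1) \<le> ?r powr (a - 1) + ?r powr a"
        proof (cases "?r \<ge> 1")
          case True
          then have "?r powr (b n - 1) \<le> ?r powr a" using ab by (intro powr_mono) auto
          then show ?thesis by (simp add: add_increasing)
        next
          case False
          then have "?r powr (b n - 1) \<le> ?r powr (a - 1)" using ab by (intro powr_mono') auto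
          then show ?thesis by (simp add: add_increasing2)
        qed
        from mult_left_mono[OF this, of "norm (exp (ray \<theta> \<rho> s))"]
        show "norm (exp (ray \<theta> \<rho> s) * ray \<theta> \<rho> s powr of_real (b n - 1) * cis \<theta>) \<le> ?w s"
          by (simp add: norm_mult norm_powr_real_powr' ring_distribs)
      qed
      show "AE s in halfline. (\<lambda>n. exp (ray \<theta> \<rho> s) * ray \<theta> \<rho> s powr of_real (b n - 1) * cis \<theta>)
          \<longlonglongrightarrow> exp (ray \<theta> \<rho> s) * ray \<theta> \<rho> s powr of_real (a - 1) * cis \<theta>"
      proof (rule AE_I2)
        fix s assume "s \<in> space halfline"
        then have "ray \<theta> \<rho> s \<notin> \<real>\<^sub>\<le>\<^sub>0" using assms by (intro ray_not_nonpos) auto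
        then show "(\<lambda>n. exp (ray \<theta> \<rho> s) * ray \<theta> \<rho> s powr of_real (b n - 1) * cis \<theta>)
          \<longlonglongrightarrow> exp (ray \<theta> \<rho> s) * ray \<theta> \<rho> s powr of_real (a - 1) * cis \<theta>"
          by (intro tendsto_intros tendsto_powr_complex b)
      qed
    qed (use assms in \<open>auto simp del: of_real_diff intro!: measurable_halfline_continuous continuous_on_mult
          continuous_on_exp continuous_on_const continuous_on_ray continuous_on_ray_powr\<close>)
    then have "(\<lambda>n. Im (hankel_integral \<theta> \<rho> (b n))) \<longlonglongrightarrow> Im (hankel_integral \<theta> \<rho> a)"
      by (rule tendsto_Im)
    moreover have "(\<lambda>n. pi * rGamma (1 - b n)) \<longlonglongrightarrow> pi * rGamma (1 - a)"
      by (intro tendsto_intros b isCont_tendsto_compose[OF isCont_rGamma]) auto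
    ultimately show ?thesis unfolding nonint[OF bn] by (rule LIMSEQ_unique)
  qed
qed

end

section \<open>Contour representation, decay and moments of the M-Wright function\<close>

locale wright_index =
  fixes \<beta> :: real
  assumes beta: "0 < \<beta>" "\<beta> < 1"
begin

text \<open>The angle has to exceed \<open>\<pi>/2\<close> for \<open>exp \<sigma>\<close> to decay, and \<open>\<beta> \<theta>\<close> has to stay below \<open>\<pi>/2\<close> for
  \<open>Re \<sigma>\<^sup>\<beta>\<close> to be positive. For this choice the second condition is \<open>\<beta> (2 - \<beta>) < 1\<close>, that is
  \<open>(1 - \<beta>)\<^sup>2 > 0\<close>.\<close>
definition "\<theta> = pi - pi * \<beta> / 2"

sublocale hankel_angle \<theta>
proof
  have "pi * \<beta> < pi * 1" using beta by (intro mult_strict_left_mono) auto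
  then show "pi / 2 < \<theta>" by (simp add: \<theta>_def)
  show "\<theta> < pi" using beta by (simp add: \<theta>_def)
qed

definition "\<kappa> = cos (\<beta> * \<theta>)"

lemma kappa_pos: "\<kappa> > 0"
proof -
  have "0 < (1 - \<beta>)\<^sup>2" using beta by simp
  then have "\<beta> * (2 - \<beta>) < 1" by (simp add: power2_eq_square algebra_simps)
  then have "pi / 2 * (\<beta> * (2 - \<beta>)) < pi / 2 * 1" by (intro mult_strict_left_mono) auto
  moreover have "pi / 2 * (\<beta> * (2 - \<beta>)) = \<beta> * \<theta>" by (simp add: \<theta>_def algebra_simps)
  ultimately have "\<beta> * \<theta> < pi / 2" by (simp only: mult_1_right)
  moreover have "\<beta> * \<theta> > 0" using beta angle by (intro mult_pos_pos) auto
  ultimately show ?thesis unfolding \<kappa>_def by (intro cos_gt_zero)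
qed

text \<open>The points of the ray have arguments between 0 and \<open>\<theta>\<close>, so the arguments of their powers are at
  most \<open>\<beta> \<theta>\<close>, whose cosine is \<open>\<kappa>\<close>; and their distance from the origin is at least \<open>\<rho> sin \<theta>\<close>.\<close>
lemma Re_ray_powr_ge:
  assumes "\<rho> > 0" "s > 0"
  shows "Re (ray \<theta> \<rho> s powr of_real \<beta>) \<ge> \<kappa> * (\<rho> * sin \<theta>) powr \<beta>"
proof -
  define w where "w = ray \<theta> \<rho> s"
  have Im: "Im w > 0" using assms sin_pos by (simp add: w_def Im_ray)
  then have w: "w \<noteq> 0" by auto
  have a: "0 < Im (Ln w)" "Im (Ln w) < pi" using Im_Ln_pos_lt[OF w] Im by auto
  have we: "w = of_real (norm w) * cis (Im (Ln w))"
    using w by (metis Arg_eq_Im_Ln rcis_cmod_Arg rcis_def Arg_def)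
  \<comment> \<open>\<open>Im (Ln w)\<close> is the argument of \<open>w\<close>; the sign of this sine shows that it does not exceed \<open>\<theta>\<close>.\<close>
  have "norm w * sin (\<theta> - Im (Ln w)) = - Im (cnj (cis \<theta>) * w)"
  proof -
    have "Re w = norm w * cos (Im (Ln w))" "Im w = norm w * sin (Im (Ln w))"
      using arg_cong[OF we, of Re] arg_cong[OF we, of Im] by simp_all
    then show ?thesis by (simp add: sin_diff algebra_simps)
  qed
  also have "\<dots> = \<rho> * sin \<theta>" by (simp add: w_def ray_def algebra_simps)
  finally have "norm w * sin (\<theta> - Im (Ln w)) > 0" using assms sin_pos by simp
  then have "sin (\<theta> - Im (Ln w)) > 0" using w by (simp add: zero_less_mult_iff)
  then have le: "Im (Ln w) \<le> \<theta>"
    using a angle sin_gt_zero[of "Im (Ln w) - \<theta>"] by (cases "Im (Ln w) \<le> \<theta>") (auto simp: sin_diff algebra_simps)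
  have "Re (w powr of_real \<beta>) = norm w powr \<beta> * cos (\<beta> * Im (Ln w))"
    using w by (simp add: powr_def Re_exp)
  moreover have "cos (\<beta> * Im (Ln w)) \<ge> \<kappa>"
  proof -
    have "\<beta> * \<theta> \<le> 1 * \<theta>" using beta angle by (intro mult_right_mono) auto
    also have "\<dots> \<le> pi" using angle by simp
    finally have "\<beta> * \<theta> \<le> pi" .
    then show ?thesis
      unfolding \<kappa>_def using beta a le by (intro cos_monotone_0_pi_le mult_left_mono) auto
  qed
  moreover have "norm w powr \<beta> \<ge> (\<rho> * sin \<theta>) powr \<beta>"
    using norm_ray_ge[of \<rho> s] assms beta sin_pos unfolding w_def by (intro powr_mono2) auto
  ultimately show ?thesis
    unfolding w_def[symmetric] using kappa_pos by (subst mult.commute[of \<kappa>]) (simp add: mult_mono)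
qed

definition wright_kernel :: "real \<Rightarrow> real \<Rightarrow> real \<Rightarrow> complex" where
  "wright_kernel \<rho> v s = exp (- (of_real v * ray \<theta> \<rho> s powr of_real \<beta>)) *
     (exp (ray \<theta> \<rho> s) * ray \<theta> \<rho> s powr of_real (\<beta> - 1) * cis \<theta>)"

lemma wright_kernel_continuous: "\<rho> > 0 \<Longrightarrow> continuous_on {0<..} (wright_kernel \<rho> v)"
  unfolding wright_kernel_def
  by (intro continuous_on_mult continuous_on_exp continuous_on_minus continuous_on_const
        continuous_on_ray continuous_on_ray_powr) auto

lemma wright_term_eq:
  assumes "\<rho> > 0" "s > 0"
  shows "ray \<theta> \<rho> s powr of_real (\<beta> * real (Suc j) - 1) =
     (ray \<theta> \<rho> s powr of_real \<beta>) ^ j * ray \<theta> \<rho> s powr of_real (\<beta> - 1)"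
proof -
  have nz: "ray \<theta> \<rho> s \<noteq> 0" using ray_not_nonpos[of s \<rho>] assms by auto
  have e: "complex_of_real (\<beta> * real (Suc j) - 1) = of_nat j * of_real \<beta> + of_real (\<beta> - 1)"
    by (simp add: algebra_simps)
  show ?thesis unfolding e powr_add powr_of_nat_mult[OF nz] ..
qed

text \<open>By Hankel's formula the coefficients are contour integrals of powers of \<open>\<sigma>\<^sup>\<beta>\<close>, and the series
  under the integral sign is exponential. Domination works because \<open>\<bar>\<sigma>\<bar>\<^sup>\<beta>\<close> grows slower than
  linearly, so \<open>exp(\<bar>z\<bar> \<bar>\<sigma>\<bar>\<^sup>\<beta>)\<close> costs only a part of the decay of \<open>exp \<sigma>\<close>.\<close>
lemma wright_series:
  assumes "\<rho> > 0"
  shows "integrable halfline (wright_kernel \<rho> z)"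
    and "(\<lambda>j. (- z) ^ j / fact j * (Gamma (\<beta> * real (Suc j)) * sin (pi * (\<beta> * real (Suc j))))) sums
           Im (integral\<^sup>L halfline (wright_kernel \<rho> z))"
proof -
  let ?r = "\<lambda>s. norm (ray \<theta> \<rho> s)"
  define f where "f = (\<lambda>(j::nat) s. of_real ((- z) ^ j / fact j) *
    (exp (ray \<theta> \<rho> s) * ray \<theta> \<rho> s powr of_real (\<beta> * real (Suc j) - 1) * cis \<theta>))"
  have fe: "f j s = (of_real (- z) * ray \<theta> \<rho> s powr of_real \<beta>) ^ j /\<^sub>R fact j *
      (exp (ray \<theta> \<rho> s) * ray \<theta> \<rho> s powr of_real (\<beta> - 1) * cis \<theta>)" if "s > 0" for j s
    unfolding f_def wright_term_eq[OF assms that]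
    by (simp add: power_mult_distrib scaleR_conv_of_real field_simps del: of_real_minus)
  obtain C where C: "C \<ge> 0" "\<And>s. s > 0 \<Longrightarrow>
       norm (exp (ray \<theta> \<rho> s) * ray \<theta> \<rho> s powr of_real (\<beta> - 1)) \<le> C * exp (- (\<gamma> / 2) * s)"
    using ray_integrand_bound[of \<rho> "\<beta> - 1"] assms by (metis atLeastAtMost_iff order_refl less_imp_le)
  have \<gamma>: "\<gamma> / 4 > 0" using cos_neg by simp
  obtain A where A: "\<And>s. s \<ge> 0 \<Longrightarrow> \<bar>z\<bar> * (\<rho> + s) powr \<beta> \<le> A + \<gamma> / 4 * s"
    by (rule sublinear_powr_bound[of \<beta> "\<gamma> / 4" "\<bar>z\<bar>" \<rho>]) (use beta \<gamma> assms in auto)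
  define g where "g = (\<lambda>s. (exp A * C) * exp (- (\<gamma> / 4) * s))"
  have dom: "(\<Sum>j<N. norm (f j s)) \<le> g s" if s: "s > 0" for N s
  proof -
    let ?E = "norm (exp (ray \<theta> \<rho> s) * ray \<theta> \<rho> s powr of_real (\<beta> - 1))"
    have "(\<Sum>j<N. norm (f j s)) = (\<Sum>j<N. (\<bar>z\<bar> * ?r s powr \<beta>) ^ j /\<^sub>R fact j) * ?E"
      unfolding sum_distrib_right using s
      by (intro sum.cong refl) (simp add: fe norm_mult norm_power norm_powr_real_powr')
    also have "\<dots> \<le> exp (\<bar>z\<bar> * ?r s powr \<beta>) * ?E"
    proof (intro mult_right_mono)
      have "(\<Sum>j<N. (\<bar>z\<bar> * ?r s powr \<beta>) ^ j /\<^sub>R fact j) \<le> (\<Sum>j. (\<bar>z\<bar> * ?r s powr \<beta>) ^ j /\<^sub>R fact j)"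
        by (intro sum_le_suminf summable_exp_generic) auto
      then show "(\<Sum>j<N. (\<bar>z\<bar> * ?r s powr \<beta>) ^ j /\<^sub>R fact j) \<le> exp (\<bar>z\<bar> * ?r s powr \<beta>)"
        by (simp add: exp_def)
    qed auto
    also have "\<dots> \<le> exp (A + \<gamma> / 4 * s) * (C * exp (- (\<gamma> / 2) * s))"
    proof (intro mult_mono C(2) s)
      have "\<bar>z\<bar> * ?r s powr \<beta> \<le> \<bar>z\<bar> * (\<rho> + s) powr \<beta>"
        using norm_ray_le[of \<rho> s] assms s beta by (intro mult_left_mono powr_mono2) auto
      also have "\<dots> \<le> A + \<gamma> / 4 * s" using A s by simp
      finally show "exp (\<bar>z\<bar> * ?r s powr \<beta>) \<le> exp (A + \<gamma> / 4 * s)" by simp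
    qed auto
    also have "\<dots> = (exp A * C) * exp (\<gamma> / 4 * s + - (\<gamma> / 2) * s)"
      by (simp only: exp_add mult_ac)
    also have "\<gamma> / 4 * s + - (\<gamma> / 2) * s = - (\<gamma> / 4) * s" by (simp add: field_simps)
    finally show ?thesis by (simp add: g_def)
  qed
  have gm: "g \<in> borel_measurable halfline"
    unfolding g_def by (intro measurable_halfline_continuous continuous_intros)
  have gi: "integrable halfline g"
    by (rule integrable_exp_decay[OF gm \<gamma>, of "\<bar>exp A * C\<bar>"]) (auto simp: g_def abs_mult)
  have sums: "(\<lambda>j. f j s) sums wright_kernel \<rho> z s" if s: "s > 0" for s
  proof -
    have "(\<lambda>j. f j s) sums (exp (of_real (- z) * ray \<theta> \<rho> s powr of_real \<beta>) *
      (exp (ray \<theta> \<rho> s) * ray \<theta> \<rho> s powr of_real (\<beta> - 1) * cis \<theta>))"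
      unfolding fe[OF s] by (intro sums_mult2 exp_converges)
    then show ?thesis by (simp add: wright_kernel_def)
  qed
  have fm: "f j \<in> borel_measurable halfline" for j
    unfolding f_def using assms
    by (intro measurable_halfline_continuous continuous_on_mult continuous_on_exp continuous_on_const
        continuous_on_ray continuous_on_ray_powr) auto
  have km: "wright_kernel \<rho> z \<in> borel_measurable halfline"
    by (intro measurable_halfline_continuous wright_kernel_continuous assms)
  note S = integrable_sums_dominated[where f = f and g = g and M = halfline and F = "wright_kernel \<rho> z"]
  show "integrable halfline (wright_kernel \<rho> z)"
    by (rule S(2)[OF fm km gi]) (use sums dom in auto)
  have "(\<lambda>j. integral\<^sup>L halfline (f j)) sums integral\<^sup>L halfline (wright_kernel \<rho> z)"
    by (rule S(3)[OF fm km gi]) (use sums dom in auto)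
  then have "(\<lambda>j. Im (integral\<^sup>L halfline (f j))) sums Im (integral\<^sup>L halfline (wright_kernel \<rho> z))"
    by (rule sums_Im)
  moreover have "Im (integral\<^sup>L halfline (f j)) =
      (- z) ^ j / fact j * (Gamma (\<beta> * real (Suc j)) * sin (pi * (\<beta> * real (Suc j))))" for j
  proof -
    have "integral\<^sup>L halfline (f j) = of_real ((- z) ^ j / fact j) * hankel_integral \<theta> \<rho> (\<beta> * real (Suc j))"
      unfolding f_def hankel_integral_def by (rule integral_mult_right_zero)
    moreover have "\<beta> * real (Suc j) > 0" using beta by (intro mult_pos_pos) auto
    moreover have "Im (of_real x * w) = x * Im w" for x w by simp
    ultimately show ?thesis
      by (simp only: Gamma_sin_eq_rGamma hankel_formula[OF assms])
  qed
  ultimately show "(\<lambda>j. (- z) ^ j / fact j * (Gamma (\<beta> * real (Suc j)) * sin (pi * (\<beta> * real (Suc j))))) sums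
           Im (integral\<^sup>L halfline (wright_kernel \<rho> z))" by simp
qed

lemma M_Wright_sums:
  "(\<lambda>j. 1 / pi * ((- z) ^ j / fact j * (Gamma (\<beta> * real (Suc j)) * sin (pi * (\<beta> * real (Suc j)))))) sums M_Wright \<beta> z"
proof -
  have "summable (\<lambda>j. (- z) ^ j / fact j * (Gamma (\<beta> * real (Suc j)) * sin (pi * (\<beta> * real (Suc j)))))"
    using wright_series(2)[of 1 z] by (auto simp: sums_iff)
  from sums_mult[OF summable_sums[OF this], of "1 / pi"] show ?thesis
    by (simp add: M_Wright_def mult.assoc)
qed

lemma M_Wright_contour:
  assumes "\<rho> > 0"
  shows "M_Wright \<beta> z = Im (integral\<^sup>L halfline (wright_kernel \<rho> z)) / pi"
  using sums_unique2[OF M_Wright_sums sums_mult[OF wright_series(2)[OF assms, of z], of "1 / pi"]] by simp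

lemma M_Wright_isCont: "isCont (M_Wright \<beta>) z"
proof -
  define c where "c = (\<lambda>j. 1 / pi * ((- 1) ^ j / fact j * (Gamma (\<beta> * real (Suc j)) * sin (pi * (\<beta> * real (Suc j))))))"
  have s: "(\<lambda>j. c j * z ^ j) sums M_Wright \<beta> z" for z
    using M_Wright_sums[of z] by (simp add: c_def power_minus[of z] mult_ac)
  then have "isCont (\<lambda>z. \<Sum>j. c j * z ^ j) z"
    by (intro isCont_powser_converges_everywhere) (auto simp: sums_iff)
  then show ?thesis using s by (simp add: sums_iff)
qed

lemma norm_wright_kernel_le:
  assumes "\<rho> > 0" "s > 0" "v \<ge> 0"
  shows "norm (wright_kernel \<rho> v s) \<le> exp (- (\<kappa> * (\<rho> * sin \<theta>) powr \<beta>) * v) *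
     norm (exp (ray \<theta> \<rho> s) * ray \<theta> \<rho> s powr of_real (\<beta> - 1) * cis \<theta>)"
proof -
  have "v * (\<kappa> * (\<rho> * sin \<theta>) powr \<beta>) \<le> v * Re (ray \<theta> \<rho> s powr of_real \<beta>)"
    using Re_ray_powr_ge[OF assms(1,2)] assms(3) by (intro mult_left_mono)
  then show ?thesis
    unfolding wright_kernel_def norm_mult[of "exp (- _)"]
    by (intro mult_right_mono) (auto simp: mult.commute)
qed

text \<open>Moving the contour to the right makes the lower bound for \<open>Re \<sigma>\<^sup>\<beta>\<close> arbitrarily large.\<close>
lemma wright_decay_rate:
  obtains \<rho> where "\<rho> > 0" "\<kappa> * (\<rho> * sin \<theta>) powr \<beta> \<ge> R"
proof -
  define \<rho> where "\<rho> = ((\<bar>R\<bar> + 1) / \<kappa>) powr (1 / \<beta>) / sin \<theta>"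
  have p: "(\<bar>R\<bar> + 1) / \<kappa> > 0" using kappa_pos by (intro divide_pos_pos) auto
  then have "((\<bar>R\<bar> + 1) / \<kappa>) powr (1 / \<beta>) > 0" by (metis powr_gt_zero less_irrefl)
  then have "\<rho> > 0" unfolding \<rho>_def using sin_pos by (intro divide_pos_pos)
  moreover have "\<kappa> * (\<rho> * sin \<theta>) powr \<beta> = \<bar>R\<bar> + 1"
    using p sin_pos kappa_pos beta by (simp add: \<rho>_def powr_powr)
  ultimately show ?thesis using that[of \<rho>] by simp
qed

text \<open>Every starting point \<open>\<rho>\<close> represents the same function, and \<open>\<bar>exp(-v \<sigma>\<^sup>\<beta>)\<bar> = exp(-v Re \<sigma>\<^sup>\<beta>)\<close>.\<close>
lemma M_Wright_decay:
  obtains C where "C \<ge> 0" "\<And>v. v \<ge> 0 \<Longrightarrow> \<bar>M_Wright \<beta> v\<bar> \<le> C * exp (- R * v)"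
proof -
  obtain \<rho> where \<rho>: "\<rho> > 0" "\<kappa> * (\<rho> * sin \<theta>) powr \<beta> \<ge> R" by (rule wright_decay_rate)
  let ?E = "\<lambda>s. norm (exp (ray \<theta> \<rho> s) * ray \<theta> \<rho> s powr of_real (\<beta> - 1) * cis \<theta>)"
  let ?C = "(LINT s|halfline. ?E s) / pi"
  have Ei: "integrable halfline ?E" using \<rho> by (intro integrable_norm ray_integrable) auto
  have "\<bar>M_Wright \<beta> v\<bar> \<le> ?C * exp (- R * v)" if v: "v \<ge> 0" for v
  proof -
    have "\<bar>Im (integral\<^sup>L halfline (wright_kernel \<rho> v))\<bar> \<le> norm (integral\<^sup>L halfline (wright_kernel \<rho> v))"
      by (rule abs_Im_le_cmod)
    also have "\<dots> \<le> (LINT s|halfline. norm (wright_kernel \<rho> v s))" by (rule integral_norm_bound)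
    also have "\<dots> \<le> (LINT s|halfline. exp (- R * v) * ?E s)"
    proof (rule integral_mono)
      show "integrable halfline (\<lambda>s. norm (wright_kernel \<rho> v s))"
        using wright_series(1)[OF \<rho>(1)] by (rule integrable_norm)
      show "integrable halfline (\<lambda>s. exp (- R * v) * ?E s)" using Ei by (rule integrable_mult_right)
      fix s assume "s \<in> space halfline"
      then have s: "s > 0" by simp
      have "R * v \<le> \<kappa> * (\<rho> * sin \<theta>) powr \<beta> * v" using \<rho> v by (intro mult_right_mono)
      then show "norm (wright_kernel \<rho> v s) \<le> exp (- R * v) * ?E s"
        by (intro order_trans[OF norm_wright_kernel_le[OF \<rho>(1) s v]] mult_right_mono) auto
    qed
    also have "\<dots> = exp (- R * v) * (LINT s|halfline. ?E s)" by (rule integral_mult_right_zero)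
    finally show ?thesis unfolding M_Wright_contour[OF \<rho>(1)] by (simp add: field_simps)
  qed
  moreover have "?C \<ge> 0" by (intro divide_nonneg_pos integral_nonneg_AE) auto
  ultimately show ?thesis using that by blast
qed

text \<open>Integrating \<open>v\<^sup>k exp(-v \<sigma>\<^sup>\<beta>)\<close> over \<open>v\<close> first gives \<open>k! \<sigma>\<^sup>-\<^sup>\<beta>\<^sup>(\<^sup>k\<^sup>+\<^sup>1\<^sup>)\<close>; what remains is Hankel's
  integral with the exponent \<open>a = -\<beta> k\<close>.\<close>
lemma M_Wright_moment:
  shows "(LINT v|halfline. v ^ k * M_Wright \<beta> v) = fact k / Gamma (\<beta> * real k + 1)"
proof -
  interpret H: sigma_finite_measure halfline by (rule sigma_finite_halfline)
  interpret P: pair_sigma_finite halfline halfline ..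
  define \<rho> :: real where "\<rho> = 1"
  have \<rho>: "\<rho> > 0" by (simp add: \<rho>_def)
  define R where "R = \<kappa> * (\<rho> * sin \<theta>) powr \<beta>"
  have R: "R > 0" using kappa_pos sin_pos by (auto simp: R_def \<rho>_def)
  let ?E = "\<lambda>s. norm (exp (ray \<theta> \<rho> s) * ray \<theta> \<rho> s powr of_real (\<beta> - 1) * cis \<theta>)"
  define F where "F = (\<lambda>v s. of_real (v ^ k) * wright_kernel \<rho> v s)"
  have [measurable]: "(\<lambda>s. ray \<theta> \<rho> s) \<in> borel_measurable halfline"
    "(\<lambda>s. ray \<theta> \<rho> s powr of_real e) \<in> borel_measurable halfline" for e
    using \<rho> by (auto intro!: measurable_halfline_continuous continuous_on_ray continuous_on_ray_powr)
  have [measurable]: "(\<lambda>p. fst p) \<in> (halfline \<Otimes>\<^sub>M halfline) \<rightarrow>\<^sub>M borel"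
    by (auto intro!: measurable_compose[OF measurable_fst] measurable_restrict_space1)
  have Fm: "case_prod F \<in> borel_measurable (halfline \<Otimes>\<^sub>M halfline)"
    unfolding F_def case_prod_unfold wright_kernel_def by measurable
  have "integrable halfline (\<lambda>v. exp (- R * v) * v powr (real (Suc k) - 1))"
    by (rule Gamma_integral_scaled) (use R in auto)
  also have "?this \<longleftrightarrow> integrable halfline (\<lambda>v. exp (- R * v) * v ^ k)"
    by (rule Bochner_Integration.integrable_cong) (auto simp: powr_realpow)
  finally have i1: "integrable halfline (\<lambda>v. exp (- R * v) * v ^ k)" .
  have i2: "integrable halfline ?E" using \<rho> by (intro integrable_norm ray_integrable) auto
  have Fi: "integrable (halfline \<Otimes>\<^sub>M halfline) (case_prod F)"
  proof (rule Bochner_Integration.integrable_bound[OF integrable_pair_product[OF i1 i2] Fm], rule AE_I2)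
    fix p assume p: "p \<in> space (halfline \<Otimes>\<^sub>M halfline)"
    obtain v s where vs_eq: "p = (v, s)" by (cases p)
    with p have vs: "v > 0" "s > 0" by (auto simp: space_pair_measure)
    have "norm (F v s) \<le> v ^ k * (exp (- R * v) * ?E s)"
      unfolding F_def norm_mult[of "of_real _"] R_def using vs \<rho>
      by (intro mult_mono norm_wright_kernel_le) (auto simp: norm_power)
    then show "norm (case_prod F p) \<le> norm (case p of (v, s) \<Rightarrow> exp (- R * v) * v ^ k * ?E s)"
      unfolding vs_eq using vs by (simp add: mult_ac norm_mult)
  qed
  have inner: "(LINT v|halfline. F v s) = of_real (fact k) *
      (exp (ray \<theta> \<rho> s) * ray \<theta> \<rho> s powr of_real (- (\<beta> * real k) - 1) * cis \<theta>)" if s: "s > 0" for s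
  proof -
    let ?b = "ray \<theta> \<rho> s powr of_real \<beta>"
    have nz: "ray \<theta> \<rho> s \<noteq> 0" using ray_not_nonpos[of s \<rho>] s \<rho> by auto
    have "Re ?b \<ge> R" unfolding R_def by (rule Re_ray_powr_ge[OF \<rho> s])
    then have b: "Re ?b > 0" using R by linarith
    have "(LINT v|halfline. F v s) = (LINT v|halfline. (exp (- ?b * of_real v) * of_real (v powr (real (Suc k) - 1))) *
        (exp (ray \<theta> \<rho> s) * ray \<theta> \<rho> s powr of_real (\<beta> - 1) * cis \<theta>))"
      by (intro Bochner_Integration.integral_cong refl)
         (auto simp: F_def wright_kernel_def powr_realpow mult_ac)
    also have "\<dots> = (of_real (Gamma (real (Suc k))) * ?b powr (- of_real (real (Suc k)))) *
        (exp (ray \<theta> \<rho> s) * ray \<theta> \<rho> s powr of_real (\<beta> - 1) * cis \<theta>)"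
      by (subst integral_mult_left_zero, subst Gamma_integral_complex_scaled) (use b in auto)
    also have "?b powr (- of_real (real (Suc k))) = ray \<theta> \<rho> s powr (- (of_nat (Suc k) * of_real \<beta>))"
      using nz by (simp only: powr_minus of_real_of_nat_eq powr_of_nat_mult powr_complexpow powr_eq_0_iff simp_thms)
    also have "Gamma (real (Suc k)) = fact k" by (simp add: Gamma_fact add.commute)
    also have "complex_of_real (fact k) * ray \<theta> \<rho> s powr (- (of_nat (Suc k) * of_real \<beta>)) *
        (exp (ray \<theta> \<rho> s) * ray \<theta> \<rho> s powr of_real (\<beta> - 1) * cis \<theta>) = of_real (fact k) *
      (exp (ray \<theta> \<rho> s) * (ray \<theta> \<rho> s powr (- (of_nat (Suc k) * of_real \<beta>)) * ray \<theta> \<rho> s powr of_real (\<beta> - 1)) * cis \<theta>)"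
      by (simp only: mult_ac)
    also have "ray \<theta> \<rho> s powr (- (of_nat (Suc k) * of_real \<beta>)) * ray \<theta> \<rho> s powr of_real (\<beta> - 1)
        = ray \<theta> \<rho> s powr of_real (- (\<beta> * real k) - 1)"
      unfolding powr_add[symmetric] by (rule arg_cong[where f = "(powr) _"]) (simp add: algebra_simps)
    finally show ?thesis .
  qed
  have "(LINT v|halfline. LINT s|halfline. F v s) = (LINT s|halfline. LINT v|halfline. F v s)"
    using P.Fubini_integral[OF Fi] by simp
  also have "\<dots> = (LINT s|halfline. of_real (fact k) *
      (exp (ray \<theta> \<rho> s) * ray \<theta> \<rho> s powr of_real (- (\<beta> * real k) - 1) * cis \<theta>))"
    by (intro Bochner_Integration.integral_cong refl inner) auto
  also have "\<dots> = of_real (fact k) * hankel_integral \<theta> \<rho> (- (\<beta> * real k))"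
    unfolding hankel_integral_def by (rule integral_mult_right_zero)
  finally have eq: "(LINT v|halfline. LINT s|halfline. F v s) = of_real (fact k) * hankel_integral \<theta> \<rho> (- (\<beta> * real k))" .
  have "integrable halfline (\<lambda>v. LINT s|halfline. F v s)"
    using P.integrable_fst[OF Fi] by simp
  then have "Im (LINT v|halfline. LINT s|halfline. F v s) = (LINT v|halfline. Im (LINT s|halfline. F v s))"
    by (rule integral_Im[symmetric])
  also have "\<dots> = (LINT v|halfline. pi * (v ^ k * M_Wright \<beta> v))"
    unfolding F_def M_Wright_contour[OF \<rho>] integral_mult_right_zero by simp
  finally have "pi * (LINT v|halfline. v ^ k * M_Wright \<beta> v) = fact k * Im (hankel_integral \<theta> \<rho> (- (\<beta> * real k)))"
    unfolding eq by simp
  also have "Im (hankel_integral \<theta> \<rho> (- (\<beta> * real k))) = pi * rGamma (1 + \<beta> * real k)"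
    using hankel_formula[OF \<rho>, of "- (\<beta> * real k)"] by simp
  also have "fact k * (pi * rGamma (1 + \<beta> * real k)) = pi * (fact k / Gamma (\<beta> * real k + 1))"
    by (simp add: rGamma_inverse_Gamma divide_inverse add.commute)
  finally show ?thesis using pi_neq_zero by (metis mult_left_cancel)
qed

end

section \<open>Caputo derivatives of power series in a fractional power\<close>

text \<open>The Beta integral, rescaled to the interval over which the Caputo derivative integrates.\<close>
lemma Beta_integral_scaled:
  fixes b c t :: real
  assumes "b > 0" "c > 0" "t > 0"
  shows "set_integrable lborel {0<..<t} (\<lambda>s. (t - s) powr (c - 1) * s powr (b - 1))"
    and "(LINT s:{0<..<t}|lborel. (t - s) powr (c - 1) * s powr (b - 1)) = t powr (b + c - 1) * Beta b c"
proof -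
  let ?g = "\<lambda>x. x powr (b - 1) * (1 - x) powr (c - 1)"
  let ?f = "\<lambda>s. indicator {0<..<t} s *\<^sub>R ((t - s) powr (c - 1) * s powr (b - 1)) :: real"
  have ind: "indicator {0..1} x *\<^sub>R ?g x = (indicator {0<..<1} x *\<^sub>R ?g x :: real)" for x
    by (cases "x = 0 \<or> x = 1") (auto simp: indicator_def)
  have gi: "integrable lborel (\<lambda>x. indicator {0<..<1} x *\<^sub>R ?g x)"
    using integrable_Beta[OF assms(1,2)] unfolding set_integrable_def ind .
  have gv: "(LINT x|lborel. indicator {0<..<1} x *\<^sub>R ?g x) = Beta b c"
    using set_borel_integral_eq_integral(2)[OF integrable_Beta[OF assms(1,2)]] has_integral_Beta_real[OF assms(1,2)]
    unfolding set_lebesgue_integral_def ind by (simp add: integral_unique)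
  have fe: "?f (0 + t * x) = t powr (b + c - 2) * (indicator {0<..<1} x *\<^sub>R ?g x)" for x
  proof (cases "x \<in> {0<..<1}")
    case True
    have "t - t * x = t * (1 - x)" by (simp add: algebra_simps)
    then have "(t - t * x) powr (c - 1) * (t * x) powr (b - 1) = (t powr (c - 1) * t powr (b - 1)) * ?g x"
      using True assms by (simp add: powr_mult)
    also have "t powr (c - 1) * t powr (b - 1) = t powr (b + c - 2)"
      by (simp add: powr_add[symmetric] algebra_simps)
    finally show ?thesis using True assms by simp
  next
    case False
    then have "t * x \<notin> {0<..<t}" using assms by (auto simp: zero_less_mult_iff)
    with False show ?thesis by simp
  qed
  show "set_integrable lborel {0<..<t} (\<lambda>s. (t - s) powr (c - 1) * s powr (b - 1))"
  proof -
    have "integrable lborel (\<lambda>x. ?f (0 + t * x))"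
      unfolding fe by (intro integrable_mult_right gi)
    then show ?thesis
      unfolding set_integrable_def using lborel_integrable_real_affine_iff[of t ?f 0] assms by simp
  qed
  have "(LINT s:{0<..<t}|lborel. (t - s) powr (c - 1) * s powr (b - 1)) = \<bar>t\<bar> *\<^sub>R (LINT x|lborel. ?f (0 + t * x))"
    unfolding set_lebesgue_integral_def using assms by (intro lborel_integral_real_affine) simp
  also have "\<dots> = t * t powr (b + c - 2) * Beta b c"
    unfolding fe integral_mult_right_zero gv using assms by simp
  also have "t * t powr (b + c - 2) = t powr (b + c - 1)"
    using assms powr_add[of t 1 "b + c - 2"] by simp
  finally show "(LINT s:{0<..<t}|lborel. (t - s) powr (c - 1) * s powr (b - 1)) = t powr (b + c - 1) * Beta b c" .
qed

text \<open>Differentiating \<open>s\<^sup>\<beta>\<^sup>k\<close> and integrating against \<open>(t - s)\<^sup>-\<^sup>\<beta>\<close> is a Beta integral; its value turns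
  \<open>t\<^sup>\<beta>\<^sup>k\<close> into \<open>\<Gamma>(\<beta> k + 1) / \<Gamma>(\<beta> (k - 1) + 1) t\<^sup>\<beta>\<^sup>(\<^sup>k\<^sup>-\<^sup>1\<^sup>)\<close>. Passing to the series is harmless: for
  \<open>s < t\<close> every term is bounded by the integrand of the lowest one, times a constant that is the
  matching term of an absolutely convergent power series at \<open>t\<^sup>\<beta>\<close>.\<close>
theorem caputo_deriv_power_series:
  fixes a :: "nat \<Rightarrow> real" and F :: "real \<Rightarrow> real"
  assumes \<beta>: "0 < \<beta>" "\<beta> < 1" and t: "t > 0"
    and summable: "\<And>y. summable (\<lambda>k. a k * y ^ k)"
    and F: "\<And>s. s \<ge> 0 \<Longrightarrow> F s = (\<Sum>k. a k * (s powr \<beta>) ^ k)"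
  shows "caputo_differentiable \<beta> F t"
    and "(\<lambda>k. a (Suc k) * (Gamma (\<beta> * real (Suc k) + 1) / Gamma (\<beta> * real k + 1)) * (t powr \<beta>) ^ k)
           sums caputo_deriv \<beta> F t"
proof -
  define \<phi> where "\<phi> = (\<lambda>y. \<Sum>k. a k * y ^ k)"
  define \<phi>' where "\<phi>' = (\<lambda>y. \<Sum>k. diffs a k * y ^ k)"
  have d\<phi>: "(\<phi> has_field_derivative \<phi>' y) (at y)" for y
    unfolding \<phi>_def \<phi>'_def by (rule termdiffs_strong_converges_everywhere[OF summable])
  have s': "summable (\<lambda>k. diffs a k * y ^ k)" for y
    by (rule termdiff_converges_all[OF summable])
  have dF: "(F has_field_derivative (\<phi>' (s powr \<beta>) * (\<beta> * s powr (\<beta> - 1)))) (at s)" if s: "s > 0" for s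
  proof -
    have "((\<lambda>s. s powr \<beta>) has_field_derivative (\<beta> * s powr (\<beta> - 1))) (at s)"
      using s by (auto intro!: derivative_eq_intros)
    from DERIV_chain2[OF d\<phi> this]
    have "((\<lambda>s. \<phi> (s powr \<beta>)) has_field_derivative (\<phi>' (s powr \<beta>) * (\<beta> * s powr (\<beta> - 1)))) (at s)" .
    then show ?thesis
      by (rule has_field_derivative_transform_within_open[of _ _ _ "{0<..}"])
         (use s F in \<open>auto simp: \<phi>_def\<close>)
  qed
  have cont: "continuous_on {0..t} F"
  proof -
    have "continuous_on {0..t} (\<lambda>s. \<phi> (s powr \<beta>))"
      by (rule continuous_on_compose2[of UNIV \<phi>])
         (use \<beta> in \<open>auto intro!: continuous_intros continuous_at_imp_continuous_on DERIV_isCont[OF d\<phi>] simp: continuous_on_powr'\<close>)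
    then show ?thesis
      by (rule continuous_on_cong[THEN iffD1, OF refl _ , rotated]) (auto simp: F \<phi>_def)
  qed
  have diff: "F differentiable_on {0<..<t}"
    unfolding differentiable_on_def
    by (metis differentiable_at_withinI dF greaterThanLessThan_iff real_differentiable_def)
  define I where "I = restrict_space lborel {0<..<t}"
  have intI: "set_integrable lborel {0<..<t} f \<longleftrightarrow> integrable I f"
    and LI: "(LINT x:{0<..<t}|lborel. f x) = integral\<^sup>L I f" for f :: "real \<Rightarrow> real"
    by (simp_all add: I_def set_integrable_def set_lebesgue_integral_def integrable_restrict_space integral_restrict_space)
  define K where "K = (\<lambda>b s. (t - s) powr (- \<beta>) * s powr (b - 1))"
  have K: "integrable I (K b)" "integral\<^sup>L I (K b) = t powr (b - \<beta>) * Beta b (1 - \<beta>)" if "b > 0" for b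
    using Beta_integral_scaled[of b "1 - \<beta>" t] that \<beta> t by (simp_all add: K_def intI LI)
  define f where "f = (\<lambda>k s. diffs a k * \<beta> * K (\<beta> * real (Suc k)) s)"
  have fe: "f k s = (diffs a k * (s powr \<beta>) ^ k) * (\<beta> * K \<beta> s)" if "s \<in> space I" for k s
  proof -
    have "s > 0" using that by (simp add: I_def)
    then have "s powr (\<beta> * real (Suc k) - 1) = (s powr \<beta>) ^ k * s powr (\<beta> - 1)"
      by (simp add: powr_power powr_add[symmetric] algebra_simps)
    then show ?thesis by (simp add: f_def K_def)
  qed
  let ?D = "\<lambda>s. 1 / (t - s) powr \<beta> * deriv F s"
  have sums: "(\<lambda>k. f k s) sums ?D s" if "s \<in> space I" for s
  proof -
    have s: "s > 0" using that by (simp add: I_def)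
    have "(\<lambda>k. f k s) sums (\<phi>' (s powr \<beta>) * (\<beta> * K \<beta> s))"
      unfolding fe[OF that] \<phi>'_def by (intro sums_mult2 summable_sums s')
    also have "\<phi>' (s powr \<beta>) * (\<beta> * K \<beta> s) = ?D s"
      using DERIV_imp_deriv[OF dF[OF s]] by (simp add: K_def powr_minus field_simps)
    finally show ?thesis .
  qed
  define B where "B = (\<Sum>k. norm (diffs a k * (t powr \<beta>) ^ k))"
  have absum: "summable (\<lambda>k. norm (diffs a k * (t powr \<beta>) ^ k))"
    by (rule powser_insidea[OF s'[of "t powr \<beta> + 1"]]) simp
  have dom: "(\<Sum>k<N. norm (f k s)) \<le> B * (\<beta> * K \<beta> s)" if sI: "s \<in> space I" for N s
  proof -
    have s: "0 < s" "s < t" using sI by (auto simp: I_def)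
    have K0: "0 \<le> \<beta> * K \<beta> s" using \<beta> by (simp add: K_def)
    have "(\<Sum>k<N. norm (f k s)) \<le> (\<Sum>k<N. norm (diffs a k * (t powr \<beta>) ^ k) * (\<beta> * K \<beta> s))"
    proof (rule sum_mono)
      fix k
      have "(s powr \<beta>) ^ k \<le> (t powr \<beta>) ^ k"
        using s \<beta> by (intro power_mono powr_mono2) auto
      then have "norm (diffs a k * (s powr \<beta>) ^ k) \<le> norm (diffs a k * (t powr \<beta>) ^ k)"
        by (simp add: abs_mult mult_left_mono)
      then have "norm (diffs a k * (s powr \<beta>) ^ k) * (\<beta> * K \<beta> s) \<le> norm (diffs a k * (t powr \<beta>) ^ k) * (\<beta> * K \<beta> s)"
        using K0 by (rule mult_right_mono)
      then show "norm (f k s) \<le> norm (diffs a k * (t powr \<beta>) ^ k) * (\<beta> * K \<beta> s)"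
        unfolding fe[OF sI] norm_mult[of _ "\<beta> * _"] using K0 by (simp only: real_norm_def abs_of_nonneg)
    qed
    also have "\<dots> \<le> B * (\<beta> * K \<beta> s)"
      unfolding sum_distrib_right[symmetric] B_def using absum K0
      by (intro mult_right_mono sum_le_suminf) auto
    finally show ?thesis .
  qed
  have fi: "integrable I (f k)" for k
    unfolding f_def by (intro integrable_mult_right K) (use \<beta> in simp)
  have "?D \<in> borel_measurable I"
    by (rule borel_measurable_LIMSEQ_real[where u = "\<lambda>N s. \<Sum>k<N. f k s"])
       (use sums fi in \<open>auto simp: sums_def intro!: borel_measurable_sum\<close>)
  note S = integrable_sums_dominated[where M = I and f = f and F = ?D and g = "\<lambda>s. B * (\<beta> * K \<beta> s)",
      OF borel_measurable_integrable[OF fi] this _ sums dom]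
  have gi: "integrable I (\<lambda>s. B * (\<beta> * K \<beta> s))"
    by (intro integrable_mult_right K \<beta>)
  show "caputo_differentiable \<beta> F t"
    unfolding caputo_differentiable_def intI using cont diff S(2)[OF gi] by auto
  have "(\<lambda>k. 1 / Gamma (1 - \<beta>) * integral\<^sup>L I (f k)) sums (1 / Gamma (1 - \<beta>) * integral\<^sup>L I ?D)"
    by (intro sums_mult S(3)[OF gi])
  also have "1 / Gamma (1 - \<beta>) * integral\<^sup>L I ?D = caputo_deriv \<beta> F t"
    by (simp add: caputo_deriv_def LI)
  also have "(\<lambda>k. 1 / Gamma (1 - \<beta>) * integral\<^sup>L I (f k)) =
    (\<lambda>k. a (Suc k) * (Gamma (\<beta> * real (Suc k) + 1) / Gamma (\<beta> * real k + 1)) * (t powr \<beta>) ^ k)"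
  proof
    fix k
    let ?b = "\<beta> * real (Suc k)"
    have b: "?b > 0" using \<beta> by simp
    have "integral\<^sup>L I (f k) = diffs a k * \<beta> * (t powr (?b - \<beta>) * Beta ?b (1 - \<beta>))"
      unfolding f_def integral_mult_right_zero K(2)[OF b] ..
    also have "t powr (?b - \<beta>) = (t powr \<beta>) ^ k"
      using t by (simp add: powr_power algebra_simps)
    also have "Beta ?b (1 - \<beta>) = Gamma ?b * Gamma (1 - \<beta>) / Gamma (\<beta> * real k + 1)"
      by (simp add: Beta_def algebra_simps)
    finally have int: "integral\<^sup>L I (f k) = a (Suc k) * (?b * Gamma ?b) * (t powr \<beta>) ^ k * Gamma (1 - \<beta>) / Gamma (\<beta> * real k + 1)"
      by (simp add: diffs_def)
    have "?b * Gamma ?b = Gamma (?b + 1)"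
      using b by (intro Gamma_plus1[symmetric]) (auto simp: nonpos_Ints_def)
    note int[unfolded this]
    moreover have "Gamma (1 - \<beta>) > 0" using \<beta> by (intro Gamma_real_pos) simp
    ultimately show "1 / Gamma (1 - \<beta>) * integral\<^sup>L I (f k) =
      a (Suc k) * (Gamma (\<beta> * real (Suc k) + 1) / Gamma (\<beta> * real k + 1)) * (t powr \<beta>) ^ k"
      by simp
  qed
  finally show "(\<lambda>k. a (Suc k) * (Gamma (\<beta> * real (Suc k) + 1) / Gamma (\<beta> * real k + 1)) * (t powr \<beta>) ^ k)
           sums caputo_deriv \<beta> F t" .
qed

section \<open>Marginals of the fractional Poisson process and their governing equation\<close>

context wright_index begin

lemma M_Wright_continuous_on: "continuous_on A (M_Wright \<beta>)"
  by (intro continuous_at_imp_continuous_on) (auto intro: M_Wright_isCont)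

text \<open>With \<open>u = t x\<^sup>-\<^sup>1\<^sup>/\<^sup>\<beta>\<close> the powers \<open>u\<^sup>-\<^sup>\<beta>\<^sup>j\<close> in the stable density are powers of \<open>z = x t\<^sup>-\<^sup>\<beta>\<close>, and
  \<open>\<Gamma>(\<beta> j + 1) / \<Gamma>(j + 1) = \<beta> \<Gamma>(\<beta> j) / (j - 1)!\<close>, so the two series agree up to a common factor.\<close>
lemma inverse_stable_density_eq:
  assumes "t > 0" "x > 0"
  shows "inverse_stable_density \<beta> t x = t powr (- \<beta>) * M_Wright \<beta> (x * t powr (- \<beta>))"
proof -
  define u where "u = t / x powr (1 / \<beta>)"
  define z where "z = x * t powr (- \<beta>)"
  have u: "u > 0" using assms by (simp add: u_def)
  have uz: "u powr (- \<beta>) = z"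
    using assms beta by (simp add: u_def z_def powr_divide powr_powr powr_minus field_simps)
  have term_eq: "(-1) ^ (Suc j + 1) * (Gamma (\<beta> * real (Suc j) + 1) / Gamma (real (Suc j) + 1))
        * (1 / u powr (\<beta> * real (Suc j) + 1)) * sin (\<beta> * pi * real (Suc j)) =
      (\<beta> * z / u * pi) * (1 / pi * ((- z) ^ j / fact j * (Gamma (\<beta> * real (Suc j)) * sin (pi * (\<beta> * real (Suc j))))))" for j
  proof -
    let ?b = "\<beta> * real (Suc j)"
    have "?b > 0" using beta by simp
    then have 1: "Gamma (?b + 1) = ?b * Gamma ?b" by (intro Gamma_plus1) (auto simp: nonpos_Ints_def)
    have 2: "Gamma (real (Suc j) + 1) = real (Suc j) * fact j"
      using Gamma_fact[of "Suc j", where 'a = real] by (simp add: add.commute)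
    have "1 / u powr (?b + 1) = inverse (u powr ?b) / u"
      using u by (simp add: powr_add divide_inverse del: of_nat_Suc)
    also have "inverse (u powr ?b) = z ^ Suc j"
      using u by (simp add: uz[symmetric] powr_minus power_inverse powr_power mult.commute del: of_nat_Suc power_Suc)
    finally have 3: "1 / u powr (?b + 1) = z ^ Suc j / u" .
    have 4: "sin (\<beta> * pi * real (Suc j)) = sin (pi * (\<beta> * real (Suc j)))" by (simp only: mult_ac)
    show ?thesis unfolding 1 2 3 4 using u
      by (simp add: power_minus[of z] field_simps del: of_nat_Suc)
  qed
  have "(\<lambda>j. (\<beta> * z / u * pi) * (1 / pi * ((- z) ^ j / fact j * (Gamma (\<beta> * real (Suc j)) * sin (pi * (\<beta> * real (Suc j)))))))
      sums ((\<beta> * z / u * pi) * M_Wright \<beta> z)"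
    by (intro sums_mult M_Wright_sums)
  then have "stable_density \<beta> u = \<beta> * z / u * M_Wright \<beta> z"
    unfolding stable_density_def term_eq by (simp add: sums_iff)
  then have "inverse_stable_density \<beta> t x = t / (\<beta> * x powr (1 + 1 / \<beta>)) * (\<beta> * z / u * M_Wright \<beta> z)"
    by (simp add: inverse_stable_density_def u_def)
  also have "\<dots> = z / x * M_Wright \<beta> z"
  proof -
    have "x powr (1 + 1 / \<beta>) = x * x powr (1 / \<beta>)" using assms by (simp add: powr_add)
    then show ?thesis using assms beta by (simp add: u_def)
  qed
  finally show ?thesis using assms by (simp add: z_def)
qed

lemma frac_poisson_prob_M_Wright:
  assumes "t > 0"
  shows "frac_poisson_prob \<beta> \<Lambda> n t =
    (LINT u|halfline. exp (- \<Lambda> u) * \<Lambda> u ^ n / fact n * (t powr (- \<beta>) * M_Wright \<beta> (u * t powr (- \<beta>))))"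
  using assms unfolding frac_poisson_prob_def halfline_set_integral
  by (auto intro!: Bochner_Integration.integral_cong simp: inverse_stable_density_eq)

text \<open>The coefficients of the \<open>n\<close>-th marginal as a series in \<open>t\<^sup>\<beta>\<close>. For \<open>n = 0\<close> the series is the
  Mittag-Leffler function \<open>E\<^sub>\<beta>(-x)\<close>, and in general it is \<open>x\<^sup>n / n!\<close> times the \<open>n\<close>-th derivative
  of \<open>E\<^sub>\<beta>\<close> at \<open>-x\<close>.\<close>
definition mittag_leffler_coeff :: "nat \<Rightarrow> nat \<Rightarrow> real" where
  "mittag_leffler_coeff n k = (- 1) ^ (n + k) * real (k choose n) / Gamma (\<beta> * real k + 1)"

text \<open>Expand \<open>exp(-T v)\<close> and insert the moments. The interchange needs \<open>exp(T v) \<bar>M\<^sub>\<beta>(v)\<bar>\<close> to be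
  integrable against powers, hence decay of \<open>M\<^sub>\<beta>\<close> at a rate above \<open>T\<close>. As \<open>T\<close> is arbitrary, the
  series converges everywhere.\<close>
lemma M_Wright_poisson_series:
  fixes n :: nat
  assumes T: "T > 0"
  defines "f \<equiv> \<lambda>v. exp (- (T * v)) * (T * v) ^ n / fact n * M_Wright \<beta> v"
  shows "integrable halfline f"
    and "(\<lambda>k. mittag_leffler_coeff n k * T ^ k) sums integral\<^sup>L halfline f"
proof -
  obtain C where C: "C \<ge> 0" "\<And>v. v \<ge> 0 \<Longrightarrow> \<bar>M_Wright \<beta> v\<bar> \<le> C * exp (- (2 * T + 1) * v)"
    by (rule M_Wright_decay[of "2 * T + 1"]) blast
  define h where "h = (\<lambda>(j::nat) v. (- 1) ^ j * T ^ (n + j) / (fact n * fact j) * (v ^ (n + j) * M_Wright \<beta> v))"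
  define g where "g = (\<lambda>v. T ^ n * C / fact n * (exp (- (T + 1) * v) * v powr (real (Suc n) - 1)))"
  have gi: "integrable halfline g"
    unfolding g_def by (intro integrable_mult_right Gamma_integral_scaled(1)) (use T in auto)
  have he: "h j v = ((T * v) ^ n / fact n * M_Wright \<beta> v) * ((- (T * v)) ^ j /\<^sub>R fact j)" for j v
    by (simp add: h_def power_add power_mult_distrib power_minus[of "T * v"] divide_inverse mult_ac)
  have sums: "(\<lambda>j. h j v) sums f v" for v
  proof -
    have "(\<lambda>j. h j v) sums (((T * v) ^ n / fact n * M_Wright \<beta> v) * exp (- (T * v)))"
      unfolding he by (intro sums_mult exp_converges)
    then show ?thesis by (simp add: f_def mult_ac)
  qed
  have dom: "(\<Sum>j<N. norm (h j v)) \<le> g v" if v: "v > 0" for N v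
  proof -
    have "(\<Sum>j<N. norm (h j v)) = ((T * v) ^ n / fact n * \<bar>M_Wright \<beta> v\<bar>) * (\<Sum>j<N. (T * v) ^ j /\<^sub>R fact j)"
      unfolding sum_distrib_left using T v
      by (intro sum.cong refl) (simp add: he abs_mult power_abs)
    also have "\<dots> \<le> ((T * v) ^ n / fact n * (C * exp (- (2 * T + 1) * v))) * exp (T * v)"
    proof (intro mult_mono mult_left_mono C)
      have "(\<Sum>j<N. (T * v) ^ j /\<^sub>R fact j) \<le> (\<Sum>j. (T * v) ^ j /\<^sub>R fact j)"
        using T v by (intro sum_le_suminf summable_exp_generic) auto
      then show "(\<Sum>j<N. (T * v) ^ j /\<^sub>R fact j) \<le> exp (T * v)" by (simp add: exp_def)
    qed (use T v C in \<open>auto intro!: sum_nonneg\<close>)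
    also have "\<dots> = (T * v) ^ n / fact n * C * exp (- (2 * T + 1) * v + T * v)"
      by (simp only: exp_add mult_ac)
    also have "- (2 * T + 1) * v + T * v = - (T + 1) * v" by (simp add: algebra_simps)
    finally show ?thesis using v by (simp add: g_def powr_realpow power_mult_distrib mult_ac)
  qed
  have hm: "h j \<in> borel_measurable halfline" for j
    unfolding h_def using M_Wright_isCont
    by (intro measurable_halfline_continuous continuous_intros continuous_at_imp_continuous_on) auto
  have fm: "f \<in> borel_measurable halfline"
    unfolding f_def using M_Wright_isCont
    by (intro measurable_halfline_continuous continuous_intros) (auto intro!: continuous_at_imp_continuous_on)
  note S = integrable_sums_dominated[where M = halfline, OF hm fm gi]
  show "integrable halfline f" by (rule S(2)) (use sums dom in auto)
  have "(\<lambda>j. integral\<^sup>L halfline (h j)) sums integral\<^sup>L halfline f"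
    by (rule S(3)) (use sums dom in auto)
  also have "(\<lambda>j. integral\<^sup>L halfline (h j)) = (\<lambda>j. mittag_leffler_coeff n (j + n) * T ^ (j + n))"
  proof
    fix j
    have "integral\<^sup>L halfline (h j) =
        (- 1) ^ j * T ^ (n + j) / (fact n * fact j) * (fact (n + j) / Gamma (\<beta> * real (n + j) + 1))"
      unfolding h_def integral_mult_right_zero M_Wright_moment ..
    also have "\<dots> = mittag_leffler_coeff n (j + n) * T ^ (j + n)"
      by (simp add: mittag_leffler_coeff_def binomial_fact power_add add_ac power2_eq_square[symmetric]
            power_mult[symmetric] field_simps)
    finally show "integral\<^sup>L halfline (h j) = mittag_leffler_coeff n (j + n) * T ^ (j + n)" .
  qed
  finally show "(\<lambda>k. mittag_leffler_coeff n k * T ^ k) sums integral\<^sup>L halfline f"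
    by (subst (asm) sums_zero_iff_shift) (auto simp: mittag_leffler_coeff_def)
qed

lemma mittag_leffler_summable: "summable (\<lambda>k. mittag_leffler_coeff n k * y ^ k)"
proof -
  have "\<bar>y\<bar> + 1 > 0" by simp
  from M_Wright_poisson_series(2)[OF this, of n]
  have "summable (\<lambda>k. mittag_leffler_coeff n k * (\<bar>y\<bar> + 1) ^ k)" by (simp add: sums_iff)
  then show ?thesis by (rule powser_inside) simp
qed

text \<open>At \<open>t = 0\<close> the constant term of the series is the initial condition.\<close>
lemma frac_poisson_prob_series:
  assumes "t \<ge> 0"
  shows "frac_poisson_prob \<beta> (\<lambda>x. x) n t = (\<Sum>k. mittag_leffler_coeff n k * (t powr \<beta>) ^ k)"
proof (cases "t = 0")
  case True
  then show ?thesis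
    using powser_zero[of "mittag_leffler_coeff n"]
    by (simp add: frac_poisson_prob_def mittag_leffler_coeff_def)
next
  case False
  then have t: "t > 0" using assms by simp
  define T where "T = t powr \<beta>"
  have T: "T > 0" "t powr (- \<beta>) = 1 / T" using t by (auto simp: T_def powr_minus_divide)
  let ?f = "\<lambda>u. exp (- u) * u ^ n / fact n * (t powr (- \<beta>) * M_Wright \<beta> (u * t powr (- \<beta>)))"
  let ?h = "\<lambda>v. exp (- (T * v)) * (T * v) ^ n / fact n * M_Wright \<beta> v"
  have eq: "T * 1 * x powr (1 - 1) * ?f (T * x powr 1) = ?h x" if "x > 0" for x
    using that T by simp
  have c: "continuous_on {0<..} ?f"
  proof -
    have "continuous_on {0<..} (\<lambda>u. M_Wright \<beta> (u * t powr (- \<beta>)))"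
      by (rule continuous_on_compose2[OF M_Wright_continuous_on[of UNIV]]) (auto intro!: continuous_intros)
    then show ?thesis by (intro continuous_intros) auto
  qed
  have "integrable halfline (\<lambda>x. T * 1 * x powr (1 - 1) * ?f (T * x powr 1))"
  proof (subst Bochner_Integration.integrable_cong[OF refl])
    show "T * 1 * x powr (1 - 1) * ?f (T * x powr 1) = ?h x" if "x \<in> space halfline" for x
      using that by (intro eq) simp
  qed (rule M_Wright_poisson_series(1)[OF T(1)])
  from integral_halfline_power_substitution(2)[OF T(1) _ c this]
  have "integral\<^sup>L halfline ?f = (LINT x|halfline. T * 1 * x powr (1 - 1) * ?f (T * x powr 1))" by simp
  also have "\<dots> = integral\<^sup>L halfline ?h"
    by (intro Bochner_Integration.integral_cong refl eq) simp
  also have "\<dots> = (\<Sum>k. mittag_leffler_coeff n k * T ^ k)"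
    using M_Wright_poisson_series(2)[OF T(1), of n] by (simp add: sums_iff)
  finally show ?thesis using frac_poisson_prob_M_Wright[OF t, of "\<lambda>x. x" n] by (simp add: T_def)
qed

text \<open>The Caputo derivative replaces the coefficient of index \<open>k\<close> by the one of index \<open>k + 1\<close>, but with
  the Gamma denominator of index \<open>k\<close>; then
  \<open>(k + 1 choose n) = (k choose n - 1) + (k choose n)\<close>, with the alternating signs, is the
  equation. For \<open>n = 0\<close> the first summand is absent.\<close>
theorem frac_poisson_kolmogorov_feller:
  assumes t: "t > 0"
  shows "caputo_differentiable \<beta> (frac_poisson_prob \<beta> (\<lambda>x. x) n) t"
    and "caputo_deriv \<beta> (frac_poisson_prob \<beta> (\<lambda>x. x) n) t =
           (if n = 0 then 0 else frac_poisson_prob \<beta> (\<lambda>x. x) (n - 1) t)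
             - frac_poisson_prob \<beta> (\<lambda>x. x) n t"
proof -
  note C = caputo_deriv_power_series[OF beta t, of "mittag_leffler_coeff n", OF mittag_leffler_summable frac_poisson_prob_series]
  show "caputo_differentiable \<beta> (frac_poisson_prob \<beta> (\<lambda>x. x) n) t" by (rule C(1))
  let ?P = "\<lambda>n. frac_poisson_prob \<beta> (\<lambda>x. x) n t"
  have P: "(\<lambda>k. mittag_leffler_coeff m k * (t powr \<beta>) ^ k) sums ?P m" for m
    unfolding frac_poisson_prob_series[OF less_imp_le[OF t]]
    by (rule summable_sums[OF mittag_leffler_summable])
  have g: "Gamma (\<beta> * real k + 1) \<noteq> 0" for k
    using Gamma_real_pos[of "\<beta> * real k + 1"] beta by (simp add: add_nonneg_pos del: Gamma_real_pos)
  have "(\<lambda>k. mittag_leffler_coeff n (Suc k) * (Gamma (\<beta> * real (Suc k) + 1) / Gamma (\<beta> * real k + 1)) * (t powr \<beta>) ^ k)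
      sums ((if n = 0 then 0 else ?P (n - 1)) - ?P n)"
  proof (cases n)
    case 0
    have "mittag_leffler_coeff n (Suc k) * (Gamma (\<beta> * real (Suc k) + 1) / Gamma (\<beta> * real k + 1))
        = - mittag_leffler_coeff n k" for k
      using g[of "Suc k"] g[of k] by (simp add: mittag_leffler_coeff_def 0 field_simps del: of_nat_Suc)
    then show ?thesis using sums_minus[OF P[of n]] by (simp only: 0) simp
  next
    case (Suc m)
    have "mittag_leffler_coeff n (Suc k) * (Gamma (\<beta> * real (Suc k) + 1) / Gamma (\<beta> * real k + 1))
        = mittag_leffler_coeff m k - mittag_leffler_coeff n k" for k
      using g[of "Suc k"] g[of k] by (simp add: mittag_leffler_coeff_def Suc field_simps del: of_nat_Suc)
    then show ?thesis using sums_diff[OF P[of m] P[of n]] by (simp add: Suc left_diff_distrib)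
  qed
  with C(2) show "caputo_deriv \<beta> (frac_poisson_prob \<beta> (\<lambda>x. x) n) t =
      (if n = 0 then 0 else ?P (n - 1)) - ?P n"
    by (rule sums_unique2)
qed

end

section \<open>Concentration of Gamma laws\<close>

text \<open>The density of \<open>1/n\<close> times a Gamma variable of shape \<open>n + 1\<close>.\<close>
definition gamma_kernel :: "nat \<Rightarrow> real \<Rightarrow> real" where
  "gamma_kernel n x = real n ^ (n + 1) / fact n * (exp (- real n * x) * x ^ n)"

text \<open>The moment of order \<open>j - 1\<close>. The shift by one includes the order \<open>-1\<close>, needed for functions that
  are singular at the origin.\<close>
definition gamma_kernel_moment :: "nat \<Rightarrow> nat \<Rightarrow> real" where
  "gamma_kernel_moment n j = Gamma (real n + real j) / fact n * real n powr (1 - real j)"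

lemma gamma_kernel_moment_integral:
  assumes "n > 0"
  shows "integrable halfline (\<lambda>x. gamma_kernel n x * x powr (real j - 1))"
    and "(LINT x|halfline. gamma_kernel n x * x powr (real j - 1)) = gamma_kernel_moment n j"
proof -
  have eq: "gamma_kernel n x * x powr (real j - 1) =
      real n ^ (n + 1) / fact n * (exp (- real n * x) * x powr (real n + real j - 1))" if "x \<in> space halfline" for x
    using that by (simp add: gamma_kernel_def powr_realpow[symmetric] powr_add[symmetric] add_diff_eq mult.assoc)
  note G = Gamma_integral_scaled[of "real n + real j" "real n"]
  show "integrable halfline (\<lambda>x. gamma_kernel n x * x powr (real j - 1))"
  proof (subst Bochner_Integration.integrable_cong[OF refl eq])
    show "integrable halfline (\<lambda>x. real n ^ (n + 1) / fact n * (exp (- real n * x) * x powr (real n + real j - 1)))"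
      by (intro integrable_mult_right G(1)) (use assms in auto)
  qed
  have "(LINT x|halfline. gamma_kernel n x * x powr (real j - 1)) =
      (LINT x|halfline. real n ^ (n + 1) / fact n * (exp (- real n * x) * x powr (real n + real j - 1)))"
    by (rule Bochner_Integration.integral_cong[OF refl eq])
  also have "\<dots> = real n ^ (n + 1) / fact n * (Gamma (real n + real j) * real n powr (- (real n + real j)))"
    unfolding integral_mult_right_zero by (subst G(2)) (use assms in auto)
  also have "\<dots> = Gamma (real n + real j) / fact n * (real n powr real (n + 1) * real n powr (- (real n + real j)))"
    using assms by (subst powr_realpow) auto
  also have "real n powr real (n + 1) * real n powr (- (real n + real j)) = real n powr (1 - real j)"
    by (simp add: powr_add[symmetric])
  finally show "(LINT x|halfline. gamma_kernel n x * x powr (real j - 1)) = gamma_kernel_moment n j"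
    by (simp add: gamma_kernel_moment_def)
qed

lemma gamma_kernel_moment_0: assumes "n > 0" shows "gamma_kernel_moment n 0 = 1"
proof -
  obtain m where "n = Suc m" using assms by (cases n) auto
  moreover have "Gamma (real (Suc m)) = fact m" using Gamma_fact[of m, where 'a = real] by (simp add: add.commute)
  ultimately show ?thesis by (simp add: gamma_kernel_moment_def divide_simps)
qed

lemma gamma_kernel_moment_Suc:
  assumes "n > 0"
  shows "gamma_kernel_moment n (Suc j) = gamma_kernel_moment n j * (1 + real j / real n)"
proof -
  have "Gamma (real n + real j + 1) = (real n + real j) * Gamma (real n + real j)"
    using assms by (intro Gamma_plus1) (auto simp: nonpos_Ints_def)
  moreover define P where "P = real n powr (1 - real j)"
  moreover have "real n powr (1 - real (Suc j)) = P / real n"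
    using assms powr_diff[of "real n" "1 - real j" 1] by (simp add: P_def)
  moreover have "gamma_kernel_moment n (Suc j) = Gamma (real n + real j + 1) / fact n * real n powr (1 - real (Suc j))"
    by (simp add: gamma_kernel_moment_def add_ac)
  ultimately have "gamma_kernel_moment n (Suc j) = (real n + real j) * Gamma (real n + real j) / fact n * (P / real n)"
    by simp
  also have "\<dots> = Gamma (real n + real j) / fact n * P * (1 + real j / real n)"
    using assms by (simp add: field_simps)
  finally show ?thesis by (simp add: gamma_kernel_moment_def P_def)
qed

lemma gamma_kernel_moment_tendsto: "(\<lambda>n. gamma_kernel_moment n j) \<longlonglongrightarrow> 1"
proof (induction j)
  case 0
  show ?case
    by (rule tendsto_eventually) (use gamma_kernel_moment_0 in \<open>auto intro: eventually_mono[OF eventually_gt_at_top]\<close>)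
next
  case (Suc j)
  have "(\<lambda>n. gamma_kernel_moment n j * (1 + real j / real n)) \<longlonglongrightarrow> 1 * (1 + 0)"
    by (intro tendsto_intros Suc lim_const_over_n)
  moreover have "\<forall>\<^sub>F n in sequentially. gamma_kernel_moment n j * (1 + real j / real n) = gamma_kernel_moment n (Suc j)"
    using eventually_gt_at_top[of 0] by eventually_elim (simp add: gamma_kernel_moment_Suc)
  ultimately show ?case using Lim_transform_eventually by force
qed

text \<open>A Chebyshev argument. Near 1 the deviation \<open>\<bar>f x - f 1\<bar>\<close> is small by continuity; elsewhere it is at
  most a constant times \<open>(x - 1)\<^sup>2 (1/x + x\<^sup>m)\<close>. The mean of the latter is a combination of moments
  with coefficients of sum 0, and every single moment tends to 1.\<close>
theorem gamma_kernel_concentration: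
  fixes f :: "real \<Rightarrow> real"
  assumes f: "f \<in> borel_measurable halfline" "isCont f 1"
    and C: "\<And>x. x > 0 \<Longrightarrow> \<bar>f x\<bar> \<le> C * (x powr - 1 + x powr real m)"
  shows "\<And>n. n > 0 \<Longrightarrow> integrable halfline (\<lambda>x. gamma_kernel n x * f x)"
    and "(\<lambda>n. LINT x|halfline. gamma_kernel n x * f x) \<longlonglongrightarrow> f 1"
proof -
  let ?w = gamma_kernel
  have w0: "?w n x \<ge> 0" if "x > 0" for n x using that by (simp add: gamma_kernel_def)
  have wm: "?w n \<in> borel_measurable halfline" for n
    unfolding gamma_kernel_def by (intro measurable_halfline_continuous continuous_intros)
  define W where "W = (\<lambda>j x::real. x powr (real j - 1))"
  have Wi: "integrable halfline (\<lambda>x. ?w n x * W j x)"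
    and WI: "(LINT x|halfline. ?w n x * W j x) = gamma_kernel_moment n j" if "n > 0" for n j
    using gamma_kernel_moment_integral[OF that] by (simp_all add: W_def)
  show fi: "integrable halfline (\<lambda>x. ?w n x * f x)" if n: "n > 0" for n
  proof (rule Bochner_Integration.integrable_bound)
    show "integrable halfline (\<lambda>x. C * (?w n x * W 0 x + ?w n x * W (m + 1) x))"
      by (intro integrable_mult_right Bochner_Integration.integrable_add Wi n)
    show "(\<lambda>x. ?w n x * f x) \<in> borel_measurable halfline"
      by (intro borel_measurable_times wm f)
    show "AE x in halfline. norm (?w n x * f x) \<le> norm (C * (?w n x * W 0 x + ?w n x * W (m + 1) x))"
    proof (rule AE_I2)
      fix x assume "x \<in> space halfline"
      then have x: "x > 0" by simp
      have "norm (?w n x * f x) \<le> ?w n x * (C * (W 0 x + W (m + 1) x))"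
        using mult_left_mono[OF C[OF x] w0[OF x, of n]] w0[OF x, of n] by (simp add: abs_mult W_def)
      also have "\<dots> = C * (?w n x * W 0 x + ?w n x * W (m + 1) x)" by (simp add: algebra_simps)
      finally show "norm (?w n x * f x) \<le> norm (C * (?w n x * W 0 x + ?w n x * W (m + 1) x))"
        by simp
    qed
  qed
  define q where "q = (\<lambda>x. W 2 x - 2 * W 1 x + W 0 x + (W (m + 3) x - 2 * W (m + 2) x + W (m + 1) x))"
  have q: "q x = (x - 1)\<^sup>2 * (x powr - 1 + x powr real m)" if "x > 0" for x
  proof -
    have WS: "W (Suc j) x = x * W j x" for j
      using that powr_add[of x 1 "real j - 1"] by (simp add: W_def)
    have "W 2 x = x * (x * W 0 x)" "W 1 x = x * W 0 x" "W (m + 3) x = x * (x * W (m + 1) x)" "W (m + 2) x = x * W (m + 1) x"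
      using WS[of 0] WS[of 1] WS[of "m + 1"] WS[of "m + 2"] by (simp_all add: numeral_2_eq_2 numeral_3_eq_3)
    then have "q x = (x - 1)\<^sup>2 * (W 0 x + W (m + 1) x)"
      by (simp add: q_def power2_eq_square algebra_simps)
    then show ?thesis by (simp add: W_def)
  qed
  define Q where "Q = (\<lambda>n. let M = gamma_kernel_moment n in M 2 - 2 * M 1 + M 0 + (M (m + 3) - 2 * M (m + 2) + M (m + 1)))"
  have wq: "(\<lambda>x. ?w n x * q x) = (\<lambda>x. ?w n x * W 2 x - 2 * (?w n x * W 1 x) + ?w n x * W 0 x +
      (?w n x * W (m + 3) x - 2 * (?w n x * W (m + 2) x) + ?w n x * W (m + 1) x))" for n
    by (simp add: q_def algebra_simps fun_eq_iff)
  have qi: "integrable halfline (\<lambda>x. ?w n x * q x)" if n: "n > 0" for n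
    unfolding wq by (intro Bochner_Integration.integrable_add Bochner_Integration.integrable_diff integrable_mult_right Wi n)
  have qI: "(LINT x|halfline. ?w n x * q x) = Q n" if n: "n > 0" for n
    unfolding wq Q_def Let_def using Wi[OF n] WI[OF n] by simp
  have Q0: "Q \<longlonglongrightarrow> 0"
  proof -
    have "Q \<longlonglongrightarrow> 1 - 2 * 1 + 1 + (1 - 2 * 1 + 1)"
      unfolding Q_def Let_def by (intro tendsto_intros gamma_kernel_moment_tendsto)
    then show ?thesis by simp
  qed
  have wi: "integrable halfline (?w n)" and wI: "integral\<^sup>L halfline (?w n) = 1" if n: "n > 0" for n
  proof -
    have eq: "?w n x = ?w n x * W 1 x" if "x \<in> space halfline" for x using that by (simp add: W_def)
    show "integrable halfline (?w n)"
      by (subst Bochner_Integration.integrable_cong[OF refl eq]) (auto intro: Wi n)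
    have "integral\<^sup>L halfline (?w n) = (LINT x|halfline. ?w n x * W 1 x)"
      by (rule Bochner_Integration.integral_cong[OF refl eq])
    also have "\<dots> = 1"
      using gamma_kernel_moment_Suc[OF n, of 0] gamma_kernel_moment_0[OF n] by (simp add: WI[OF n])
    finally show "integral\<^sup>L halfline (?w n) = 1" .
  qed
  show "(\<lambda>n. LINT x|halfline. ?w n x * f x) \<longlonglongrightarrow> f 1"
  proof (rule LIMSEQ_I)
    fix e :: real assume e: "e > 0"
    from f(2) e obtain \<delta> where \<delta>: "\<delta> > 0" "\<And>x. \<bar>x - 1\<bar> < \<delta> \<Longrightarrow> \<bar>f x - f 1\<bar> < e / 2"
      unfolding continuous_at_eps_delta dist_real_def by (metis half_gt_zero)
    define K where "K = (\<bar>C\<bar> + \<bar>f 1\<bar>) / \<delta>\<^sup>2"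
    have K: "K \<ge> 0" by (simp add: K_def)
    have bound: "\<bar>f x - f 1\<bar> \<le> e / 2 + K * q x" if x: "x > 0" for x
    proof (cases "\<bar>x - 1\<bar> < \<delta>")
      case True
      have "0 \<le> K * q x" using K by (simp add: q[OF x])
      with \<delta>(2)[OF True] show ?thesis by linarith
    next
      case False
      let ?b = "x powr - 1 + x powr real m"
      have b: "?b \<ge> 1"
      proof (cases "x \<ge> 1")
        case True
        then have "1 \<le> x powr real m" by (simp add: ge_one_powr_ge_zero)
        then show ?thesis by (simp add: add_increasing)
      next
        case False
        then have "1 \<le> x powr - 1" using x by (simp add: powr_minus field_simps)
        then show ?thesis by (simp add: add_increasing2)
      qed
      have "\<bar>f x - f 1\<bar> \<le> \<bar>C\<bar> * ?b + \<bar>f 1\<bar> * ?b"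
      proof -
        have "\<bar>f x\<bar> \<le> \<bar>C\<bar> * ?b"
          using C[OF x] b by (intro order_trans[OF C[OF x]] mult_right_mono) auto
        moreover have "\<bar>f 1\<bar> \<le> \<bar>f 1\<bar> * ?b" using mult_left_mono[OF b, of "\<bar>f 1\<bar>"] by simp
        ultimately show ?thesis by linarith
      qed
      also have "\<dots> = (\<bar>C\<bar> + \<bar>f 1\<bar>) * ?b * 1" by (simp add: algebra_simps)
      also have "\<dots> \<le> (\<bar>C\<bar> + \<bar>f 1\<bar>) * ?b * ((x - 1)\<^sup>2 / \<delta>\<^sup>2)"
      proof (rule mult_left_mono)
        have "\<delta>\<^sup>2 \<le> \<bar>x - 1\<bar>\<^sup>2" using False \<delta>(1) by (intro power_mono) auto
        then show "1 \<le> (x - 1)\<^sup>2 / \<delta>\<^sup>2" using \<delta>(1) by simp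
      qed (use b in auto)
      also have "\<dots> = K * q x" by (simp add: K_def q[OF x])
      finally show ?thesis using e by simp
    qed
    have est: "\<bar>(LINT x|halfline. ?w n x * f x) - f 1\<bar> \<le> e / 2 + K * Q n" if n: "n > 0" for n
    proof -
      have "(LINT x|halfline. ?w n x * f x) - f 1 = (LINT x|halfline. ?w n x * f x - ?w n x * f 1)"
        using fi[OF n] wi[OF n] wI[OF n] by simp
      then have "\<bar>(LINT x|halfline. ?w n x * f x) - f 1\<bar> \<le> (LINT x|halfline. norm (?w n x * f x - ?w n x * f 1))"
        using integral_norm_bound[of halfline "\<lambda>x. ?w n x * f x - ?w n x * f 1"] by simp
      also have "\<dots> \<le> (LINT x|halfline. e / 2 * ?w n x + K * (?w n x * q x))"
      proof (rule integral_mono)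
        show "integrable halfline (\<lambda>x. norm (?w n x * f x - ?w n x * f 1))"
          using fi[OF n] wi[OF n] by (intro integrable_norm Bochner_Integration.integrable_diff) auto
        show "integrable halfline (\<lambda>x. e / 2 * ?w n x + K * (?w n x * q x))"
          by (intro Bochner_Integration.integrable_add integrable_mult_right wi qi n)
        fix x assume "x \<in> space halfline"
        then have x: "x > 0" by simp
        have "norm (?w n x * f x - ?w n x * f 1) = ?w n x * \<bar>f x - f 1\<bar>"
          using w0[OF x, of n] by (simp add: abs_mult right_diff_distrib[symmetric])
        also have "\<dots> \<le> ?w n x * (e / 2 + K * q x)"
          using bound[OF x] w0[OF x] by (rule mult_left_mono)
        finally show "norm (?w n x * f x - ?w n x * f 1) \<le> e / 2 * ?w n x + K * (?w n x * q x)"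
          by (simp add: algebra_simps)
      qed
      also have "\<dots> = e / 2 + K * Q n"
        using wi[OF n] qi[OF n] by (simp add: wI[OF n] qI[OF n])
      finally show ?thesis .
    qed
    have "(\<lambda>n. K * Q n) \<longlonglongrightarrow> K * 0" by (intro tendsto_intros Q0)
    then have "(\<lambda>n. K * Q n) \<longlonglongrightarrow> 0" by simp
    from order_tendstoD(2)[OF this, of "e / 2"] e
    have "\<forall>\<^sub>F n in sequentially. K * Q n < e / 2" by simp
    then obtain N where N: "\<And>n. n \<ge> N \<Longrightarrow> K * Q n < e / 2" by (auto simp: eventually_sequentially)
    show "\<exists>no. \<forall>n\<ge>no. norm ((LINT x|halfline. ?w n x * f x) - f 1) < e"
    proof (intro exI[of _ "max N 1"] allI impI)
      fix n assume "max N 1 \<le> n"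
      then show "norm ((LINT x|halfline. ?w n x * f x) - f 1) < e"
        using est[of n] N[of n] by simp
    qed
  qed
qed

section \<open>The scaling limit\<close>

text \<open>On the curve \<open>t\<close> is an increasing function of \<open>n\<close>, so that the limit is one along the integers.\<close>
lemma tendsto_scaling_filter:
  fixes g :: "nat \<times> real \<Rightarrow> real"
  assumes "\<alpha> > 0" "c > 0" "X \<longlonglongrightarrow> L"
    and g: "\<And>n t. n > 0 \<Longrightarrow> t > 0 \<Longrightarrow> real n * t powr (- \<alpha>) = c \<Longrightarrow> g (n, t) = X n"
  shows "(g \<longlongrightarrow> L) (scaling_filter \<alpha> c)"
proof (rule tendstoI)
  fix e :: real assume "e > 0"
  with assms(3) obtain N where N: "\<And>n. n \<ge> N \<Longrightarrow> dist (X n) L < e" by (auto simp: lim_sequentially)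
  show "\<forall>\<^sub>F p in scaling_filter \<alpha> c. dist (g p) L < e"
    unfolding eventually_scaling_filter
  proof (intro exI[of _ "(real N / c) powr (1 / \<alpha>)"] allI impI)
    fix n t
    assume t: "(real N / c) powr (1 / \<alpha>) \<le> t" "0 < t" and n: "0 < n" and eq: "real n * t powr (- \<alpha>) = c"
    have "real N / c = ((real N / c) powr (1 / \<alpha>)) powr \<alpha>"
      using assms by (simp add: powr_powr)
    also have "\<dots> \<le> t powr \<alpha>" using t assms by (intro powr_mono2) auto
    also have "t powr \<alpha> = real n / c" using eq t assms by (simp add: powr_minus field_simps)
    finally have "N \<le> n" using assms by (simp add: divide_right_mono field_simps)
    then show "dist (g (n, t)) L < e" using N g[OF n t(2) eq] by simp
  qed
qed

context wright_index begin

text \<open>The substitution is \<open>u = A x\<^sup>1\<^sup>/\<^sup>r\<close> with \<open>A = t\<^sup>\<beta> z\<^sub>0\<close>; on the curve \<open>A\<^sup>r = n\<close>, so \<open>u\<^sup>r = n x\<close>. The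
  factor \<open>x\<^sup>1\<^sup>/\<^sup>r\<^sup>-\<^sup>1\<close> of the Jacobian is singular at the origin for \<open>r > 1\<close>, but not worse than
  \<open>1/x\<close>, and \<open>M\<^sub>\<beta>\<close> is bounded.\<close>
theorem frac_poisson_scaling_limit:
  assumes r: "r > 0" and z0: "z0 > 0"
  shows "((\<lambda>(n, t). t powr (r * \<beta>) * frac_poisson_prob \<beta> (\<lambda>x. x powr r) n t)
           \<longlongrightarrow> z0 powr (1 - r) / r * M_Wright \<beta> z0) (scaling_filter (r * \<beta>) (z0 powr r))"
proof -
  define f where "f = (\<lambda>x. z0 powr (1 - r) / r * (x powr (1 / r - 1) * M_Wright \<beta> (z0 * x powr (1 / r))))"
  have M: "continuous_on {0<..} (\<lambda>x. M_Wright \<beta> (z0 * x powr (1 / r)))"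
    by (rule continuous_on_compose2[OF M_Wright_continuous_on[of UNIV]]) (auto intro!: continuous_intros)
  have fc: "continuous_on {0<..} f"
    unfolding f_def by (intro continuous_intros M) auto
  then have f1: "isCont f 1" by (simp add: continuous_on_eq_continuous_at)
  obtain B where B: "B \<ge> 0" "\<And>v. v \<ge> 0 \<Longrightarrow> \<bar>M_Wright \<beta> v\<bar> \<le> B * exp (- 0 * v)"
    by (rule M_Wright_decay[of 0]) blast
  define m where "m = nat \<lceil>1 / r\<rceil>"
  have bnd: "\<bar>f x\<bar> \<le> (z0 powr (1 - r) / r * B) * (x powr - 1 + x powr real m)" if x: "x > 0" for x
  proof -
    have "x powr (1 / r - 1) \<le> x powr - 1 + x powr real m"
    proof (cases "x \<ge> 1")
      case True
      have "1 / r - 1 \<le> real m" unfolding m_def by linarith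
      with True have "x powr (1 / r - 1) \<le> x powr real m" by (intro powr_mono)
      then show ?thesis by (simp add: add_increasing)
    next
      case False
      then have "x powr (1 / r - 1) \<le> x powr - 1" using x r by (intro powr_mono') auto
      then show ?thesis by (simp add: add_increasing2)
    qed
    moreover have "\<bar>M_Wright \<beta> (z0 * x powr (1 / r))\<bar> \<le> B" using B(2)[of "z0 * x powr (1 / r)"] z0 by simp
    ultimately have "x powr (1 / r - 1) * \<bar>M_Wright \<beta> (z0 * x powr (1 / r))\<bar> \<le> (x powr - 1 + x powr real m) * B"
      using B by (intro mult_mono) auto
    from mult_left_mono[OF this, of "z0 powr (1 - r) / r"] r show ?thesis
      by (simp add: f_def abs_mult mult_ac)
  qed
  note conc = gamma_kernel_concentration[OF measurable_halfline_continuous[OF fc] f1 bnd]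
  have "((\<lambda>(n, t). t powr (r * \<beta>) * frac_poisson_prob \<beta> (\<lambda>x. x powr r) n t) \<longlongrightarrow> f 1)
      (scaling_filter (r * \<beta>) (z0 powr r))"
  proof (rule tendsto_scaling_filter[OF _ _ conc(2)])
    fix n :: nat and t :: real
    assume n: "n > 0" and t: "t > 0" and eq: "real n * t powr (- (r * \<beta>)) = z0 powr r"
    define A where "A = t powr \<beta> * z0"
    have A: "A > 0" using t z0 by (simp add: A_def)
    have tr: "t powr (r * \<beta>) = real n / z0 powr r"
      using eq t z0 by (simp add: powr_minus field_simps)
    have Ar: "A powr r = real n"
      using t z0 by (simp add: A_def powr_mult powr_powr mult.commute[of \<beta>] tr)
    let ?g = "\<lambda>u. exp (- (u powr r)) * (u powr r) ^ n / fact n * (t powr (- \<beta>) * M_Wright \<beta> (u * t powr (- \<beta>)))"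
    have sub: "A * (1 / r) * x powr (1 / r - 1) * ?g (A * x powr (1 / r)) = 1 / t powr (r * \<beta>) * (gamma_kernel n x * f x)"
      if "x \<in> space halfline" for x
    proof -
      have x: "x > 0" using that by simp
      have 1: "(A * x powr (1 / r)) powr r = real n * x"
        using A x r by (simp add: powr_mult powr_powr Ar)
      have 2: "A * x powr (1 / r) * t powr (- \<beta>) = z0 * x powr (1 / r)"
        using t by (simp add: A_def powr_minus)
      have 3: "A * t powr (- \<beta>) = z0" using t by (simp add: A_def powr_minus)
      have 4: "z0 powr (1 - r) = z0 / z0 powr r" using z0 by (simp add: powr_diff)
      have "A * (1 / r) * x powr (1 / r - 1) * ?g (A * x powr (1 / r)) =
        (A * t powr (- \<beta>)) / r * x powr (1 / r - 1) * (exp (- (real n * x)) * (real n * x) ^ n / fact n) *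
          M_Wright \<beta> (z0 * x powr (1 / r))"
        unfolding 1 2 by (simp add: mult_ac)
      also have "\<dots> = 1 / t powr (r * \<beta>) * (gamma_kernel n x * f x)"
        unfolding 3 tr f_def gamma_kernel_def 4 using n z0 by (simp add: power_mult_distrib mult_ac)
      finally show ?thesis .
    qed
    have "continuous_on {0<..} (\<lambda>u. M_Wright \<beta> (u * t powr (- \<beta>)))"
      by (rule continuous_on_compose2[OF M_Wright_continuous_on[of UNIV]]) (auto intro!: continuous_intros)
    then have gc: "continuous_on {0<..} ?g" by (intro continuous_intros) auto
    have "integrable halfline (\<lambda>x. A * (1 / r) * x powr (1 / r - 1) * ?g (A * x powr (1 / r)))"
    proof (subst Bochner_Integration.integrable_cong[OF refl sub])
      show "integrable halfline (\<lambda>x. 1 / t powr (r * \<beta>) * (gamma_kernel n x * f x))"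
        by (intro integrable_mult_right conc(1) n)
    qed
    note S = integral_halfline_power_substitution(2)[OF A _ gc this]
    have "integral\<^sup>L halfline ?g = (LINT x|halfline. A * (1 / r) * x powr (1 / r - 1) * ?g (A * x powr (1 / r)))"
      by (rule S) (use r in simp)
    also have "\<dots> = (LINT x|halfline. 1 / t powr (r * \<beta>) * (gamma_kernel n x * f x))"
      by (rule Bochner_Integration.integral_cong[OF refl sub])
    also have "\<dots> = 1 / t powr (r * \<beta>) * (LINT x|halfline. gamma_kernel n x * f x)"
      by (rule integral_mult_right_zero)
    finally show "(case (n, t) of (n, t) \<Rightarrow> t powr (r * \<beta>) * frac_poisson_prob \<beta> (\<lambda>x. x powr r) n t) =
        (LINT x|halfline. gamma_kernel n x * f x)"
      using t by (simp add: frac_poisson_prob_M_Wright[OF t])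
  qed (use r z0 beta in auto)
  then show ?thesis by (simp add: f_def)
qed

end

theorem corollary2:
  fixes \<beta> r :: real
  assumes "0 < \<beta>" and "\<beta> < 1" and "r > 0"
  shows
    "(\<forall>z0>0.
        ((\<lambda>(n, t). t powr (r * \<beta>) * frac_poisson_prob \<beta> (\<lambda>x. x powr r) n t)
           \<longlongrightarrow> z0 powr (1 - r) / r * M_Wright \<beta> z0)
          (scaling_filter (r * \<beta>) (z0 powr r)))
     \<and>
     (frac_poisson_prob \<beta> (\<lambda>x. x) 0 0 = 1 \<and>
      (\<forall>n\<ge>1. frac_poisson_prob \<beta> (\<lambda>x. x) n 0 = 0) \<and>
      (\<forall>n. \<forall>t>0.
         caputo_differentiable \<beta> (frac_poisson_prob \<beta> (\<lambda>x. x) n) t \<and>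
         caputo_deriv \<beta> (frac_poisson_prob \<beta> (\<lambda>x. x) n) t =
           (if n = 0 then 0 else frac_poisson_prob \<beta> (\<lambda>x. x) (n - 1) t)
             - frac_poisson_prob \<beta> (\<lambda>x. x) n t))
     \<and>
     (\<forall>z0>0.
        ((\<lambda>(n, t). t powr \<beta> * frac_poisson_prob \<beta> (\<lambda>x. x) n t)
           \<longlongrightarrow> M_Wright \<beta> z0)
          (scaling_filter \<beta> z0))"
proof -
  interpret wright_index \<beta> by unfold_locales (use assms in auto)
  have id: "frac_poisson_prob \<beta> (\<lambda>x. x powr 1) n t = frac_poisson_prob \<beta> (\<lambda>x. x) n t" for n t
    unfolding frac_poisson_prob_def by (auto intro!: set_lebesgue_integral_cong)
  have "((\<lambda>(n, t). t powr \<beta> * frac_poisson_prob \<beta> (\<lambda>x. x) n t) \<longlongrightarrow> M_Wright \<beta> z0)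
          (scaling_filter \<beta> z0)" if "z0 > 0" for z0
    using frac_poisson_scaling_limit[of 1 z0, unfolded id] that by simp
  moreover have "frac_poisson_prob \<beta> (\<lambda>x. x) 0 0 = 1" "\<forall>n\<ge>1. frac_poisson_prob \<beta> (\<lambda>x. x) n 0 = 0"
    by (simp_all add: frac_poisson_prob_def)
  ultimately show ?thesis
    using frac_poisson_scaling_limit assms frac_poisson_kolmogorov_feller by blast
qed

end
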